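(* Let $(X,d)=\bigsqcup_{n\in\mathbb N}(X_n,d_n)$ be a sparse space with bounded geometry and $H_0$ be a Hilbert space. Let $P\in\mathfrak B(\ell^2(X;H_0))$ be a block-rank-one projection with respect to $\{(X_n,d_n)\}_{n\in\mathbb N}$, and let $m_n$ be the associated probability measure on $X_n$. Then the following hold: - If $H_0=\ell^2(\mathbb N)$, then $P$ belongs to the Roe algebra $C^*(X)$ if and only if $\{(X_n,d_n,m_n)\}_{n\in\mathbb N}$ is a sequence of measured asymptotic expanders. - If $H_0=\mathbb C$, then $P$ belongs to the uniform Roe algebra $C^*_u(X)$ if and only if $\{(X_n,d_n,m_n)\}_{n\in\mathbb N}$ is a sequence of measured asymptotic expanders.
   Context: $(X,d)$ has bounded geometry if $\sup_{x\in X}|B(x,R)|<\infty$ for each $R>0$ (closed balls). $(X,d)=\bigsqcup_{n}(X_n,d_n)$ being sparse means that $X$ is the disjoint union of the $X_n$, $0<|X_n|<\infty$, $d_n=d|_{X_n}$, and $d(X_n,X_m)\to\infty$ as $n+m\to\infty$, $n\ne m$. A block-rank-one projection with respect to $\{(X_n,d_n)\}_n$ is a projection $P=\bigoplus_nP_n\in\mathfrak B(\bigoplus_n\ell^2(X_n;H_0))=\mathfrak B(\ell^2(X;H_0))$ where each $P_n\in\mathfrak B(\ell^2(X_n;H_0))$ is a rank-one (orthogonal) projection. Writing $P_n(\eta)=\langle\eta,\xi_n\rangle\xi_n$ with a unit vector $\xi_n\in\ell^2(X_n;H_0)$, the associated probability measure is $m_n(x)=\|\xi_n(x)\|^2$,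 $x\in X_n$. A sequence of finite probability-measured metric spaces $\{(X_n,d_n,m_n)\}_n$ is a sequence of measured asymptotic expanders if for every $\alpha\in(0,\frac12]$ there exist $c_\alpha\in(0,1)$ and $R_\alpha>0$ such that for every $n$ and every $A\subseteq X_n$ with $\alpha\le m_n(A)\le\frac12$ one has $m_n(\partial_{R_\alpha}A)>c_\alpha m_n(A)$, where $\partial_RA=\{x\in X_n\setminus A:d_n(x,A)\le R\}$. Write $T\in\mathfrak B(\ell^2(X;H_0))$ as a matrix $(T_{x,y})_{x,y\in X}$ with entries in $\mathfrak B(H_0)$. $T$ has finite propagation if $\sup\{d(x,y):T_{x,y}\ne0\}<\infty$, and is locally compact if all $T_{x,y}$ are compact. $C^*_u(X)$ is the norm closure of the finite propagation operators in $\mathfrak B(\ell^2(X))$; $C^*(X)$ is the norm closure of the finite propagation locally compact operators in $\mathfrak B(\ell^2(X;\ell^2(\mathbb N)))$. *)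

theory Defs
  imports "HOL-Analysis.Analysis"
begin

section \<open>Complex Hilbert spaces\<close>

text \<open>The distribution has real inner product spaces only. The complex inner product is linear in
  its first argument, and the real inner product (hence norm and topology) is its real part.\<close>

class complex_hilbert = real_inner + banach +
  fixes scaleC :: "complex \<Rightarrow> 'a \<Rightarrow> 'a" (infixr "*\<^sub>C" 75)
    and cinner :: "'a \<Rightarrow> 'a \<Rightarrow> complex"
  assumes scaleC_add_right: "c *\<^sub>C (x + y) = c *\<^sub>C x + c *\<^sub>C y"
    and scaleC_add_left: "(b + c) *\<^sub>C x = b *\<^sub>C x + c *\<^sub>C x"
    and scaleC_scaleC: "b *\<^sub>C c *\<^sub>C x = (b * c) *\<^sub>C x"
    and scaleC_of_real: "complex_of_real r *\<^sub>C x = r *\<^sub>R x"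
    and cinner_commute: "cinner x y = cnj (cinner y x)"
    and cinner_add_left: "cinner (x + y) z = cinner x z + cinner y z"
    and cinner_scaleC_left: "cinner (c *\<^sub>C x) y = c * cinner x y"
    and Re_cinner: "Re (cinner x y) = inner x y"

instantiation complex :: complex_hilbert
begin
definition scaleC_complex :: "complex \<Rightarrow> complex \<Rightarrow> complex" where
  "scaleC_complex c z = c * z"
definition cinner_complex :: "complex \<Rightarrow> complex \<Rightarrow> complex" where
  "cinner_complex z w = z * cnj w"
instance
  by standard
    (auto simp: scaleC_complex_def cinner_complex_def algebra_simps scaleR_conv_of_real
      inner_complex_def)
end

lemma cinner_scaleC_right: "cinner x (c *\<^sub>C y) = cnj c * cinner x y"
  by (metis cinner_commute cinner_scaleC_left complex_cnj_mult)

lemma cinner_self: "cinner x x = complex_of_real ((norm x)\<^sup>2)"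
proof -
  have "Im (cinner x x) = 0"
    using arg_cong[OF cinner_commute[of x x], of Im] by simp
  then show ?thesis
    by (simp add: complex_eq_iff Re_cinner power2_norm_eq_inner)
qed

lemma norm_scaleC: "norm (c *\<^sub>C x) = cmod c * norm x"
proof -
  have "complex_of_real ((norm (c *\<^sub>C x))\<^sup>2) = c * cnj c * cinner x x"
    by (simp only: cinner_scaleC_left cinner_scaleC_right mult_ac flip: cinner_self)
  also have "\<dots> = complex_of_real ((cmod c * norm x)\<^sup>2)"
    by (simp add: cinner_self power_mult_distrib complex_norm_square[symmetric] del: of_real_power flip: of_real_mult of_real_power)
  finally have "(norm (c *\<^sub>C x))\<^sup>2 = (cmod c * norm x)\<^sup>2"
    by (simp only: of_real_eq_iff)
  then show ?thesis
    by (simp add: power2_eq_iff_nonneg)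
qed

lemma norm_cinner_le: "cmod (cinner x y) \<le> norm x * norm y"
proof (cases "cinner x y = 0")
  case False
  define c where "c = cnj (sgn (cinner x y))"
  have "c * cinner x y = complex_of_real (cmod (cinner x y))"
    using False
    by (simp add: c_def sgn_eq complex_norm_square[symmetric] power2_eq_square mult.commute)
  then have "cmod (cinner x y) = Re (cinner (c *\<^sub>C x) y)"
    by (simp add: cinner_scaleC_left)
  also have "\<dots> \<le> norm (c *\<^sub>C x) * norm y"
    by (simp add: Re_cinner norm_cauchy_schwarz)
  also have "\<dots> = norm x * norm y"
    using False by (simp add: norm_scaleC c_def norm_sgn)
  finally show ?thesis .
qed simp

section \<open>The Hilbert space of square-summable functions\<close>

typedef (overloaded) ('a, 'h) l2 =
  "{f :: 'a \<Rightarrow> 'h::complex_hilbert. (\<lambda>x. (norm (f x))\<^sup>2) summable_on UNIV}"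
  morphisms l2_apply Abs_l2
  by (rule exI[of _ "\<lambda>_. 0"]) simp

setup_lifting type_definition_l2

lemma l2_summable: "(\<lambda>x. (norm (l2_apply f x))\<^sup>2) summable_on UNIV"
  using l2_apply by blast

lemma l2_summable_add:
  fixes f g :: "'a \<Rightarrow> 'h::complex_hilbert"
  assumes "(\<lambda>x. (norm (f x))\<^sup>2) summable_on UNIV" "(\<lambda>x. (norm (g x))\<^sup>2) summable_on UNIV"
  shows "(\<lambda>x. (norm (f x + g x))\<^sup>2) summable_on UNIV"
proof -
  have "(\<lambda>x. norm ((norm (f x + g x))\<^sup>2)) summable_on UNIV"
  proof (rule Infinite_Sum.abs_summable_on_comparison_test')
    show "(\<lambda>x. 2 * (norm (f x))\<^sup>2 + 2 * (norm (g x))\<^sup>2) summable_on UNIV"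
      by (intro summable_on_add summable_on_cmult_right assms)
    fix x
    have "(norm (f x + g x))\<^sup>2 \<le> (norm (f x) + norm (g x))\<^sup>2"
      by (simp add: norm_triangle_ineq power_mono)
    also have "\<dots> \<le> 2 * (norm (f x))\<^sup>2 + 2 * (norm (g x))\<^sup>2"
      using sum_squares_ge_zero[of "norm (f x) - norm (g x)" 0]
      by (simp add: power2_eq_square algebra_simps)
    finally show "norm ((norm (f x + g x))\<^sup>2) \<le> 2 * (norm (f x))\<^sup>2 + 2 * (norm (g x))\<^sup>2"
      by simp
  qed
  then show ?thesis by simp
qed

lemma l2_summable_scaleC:
  fixes f :: "'a \<Rightarrow> 'h::complex_hilbert"
  assumes "(\<lambda>x. (norm (f x))\<^sup>2) summable_on UNIV"
  shows "(\<lambda>x. (norm (c *\<^sub>C f x))\<^sup>2) summable_on UNIV"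
  using summable_on_cmult_right[OF assms, of "(cmod c)\<^sup>2"]
  by (simp add: norm_scaleC power_mult_distrib)

lemma l2_summable_cinner:
  fixes f g :: "'a \<Rightarrow> 'h::complex_hilbert"
  assumes "(\<lambda>x. (norm (f x))\<^sup>2) summable_on UNIV" "(\<lambda>x. (norm (g x))\<^sup>2) summable_on UNIV"
  shows "(\<lambda>x. cinner (f x) (g x)) summable_on UNIV"
proof (rule abs_summable_summable, rule Infinite_Sum.abs_summable_on_comparison_test')
  show "(\<lambda>x. (norm (f x))\<^sup>2 + (norm (g x))\<^sup>2) summable_on UNIV"
    by (intro summable_on_add assms)
  fix x
  have "0 \<le> norm (f x) * norm (g x)"
    by simp
  moreover have "2 * (norm (f x) * norm (g x)) \<le> (norm (f x))\<^sup>2 + (norm (g x))\<^sup>2"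
    using sum_squares_ge_zero[of "norm (f x) - norm (g x)" 0]
    by (simp add: power2_eq_square algebra_simps)
  ultimately show "norm (cinner (f x) (g x)) \<le> (norm (f x))\<^sup>2 + (norm (g x))\<^sup>2"
    using norm_cinner_le[of "f x" "g x"] by linarith
qed

instantiation l2 :: (type, complex_hilbert) real_inner
begin

lift_definition zero_l2 :: "('a, 'b) l2" is "\<lambda>_. 0" by simp

lift_definition plus_l2 :: "('a, 'b) l2 \<Rightarrow> ('a, 'b) l2 \<Rightarrow> ('a, 'b) l2"
  is "\<lambda>f g x. f x + g x" by (rule l2_summable_add)

lift_definition uminus_l2 :: "('a, 'b) l2 \<Rightarrow> ('a, 'b) l2"
  is "\<lambda>f x. - f x" by simp

lift_definition minus_l2 :: "('a, 'b) l2 \<Rightarrow> ('a, 'b) l2 \<Rightarrow> ('a, 'b) l2"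
  is "\<lambda>f g x. f x - g x"
  using l2_summable_add[of _ "\<lambda>x. - _ x"] by simp

lift_definition scaleR_l2 :: "real \<Rightarrow> ('a, 'b) l2 \<Rightarrow> ('a, 'b) l2"
  is "\<lambda>r f x. r *\<^sub>R f x"
  using l2_summable_scaleC[of _ "complex_of_real _"] by (simp add: scaleC_of_real)

definition inner_l2 :: "('a, 'b) l2 \<Rightarrow> ('a, 'b) l2 \<Rightarrow> real" where
  "inner_l2 f g = (\<Sum>\<^sub>\<infinity>x. inner (l2_apply f x) (l2_apply g x))"
definition norm_l2 :: "('a, 'b) l2 \<Rightarrow> real" where
  "norm_l2 f = sqrt (\<Sum>\<^sub>\<infinity>x. (norm (l2_apply f x))\<^sup>2)"
definition dist_l2 :: "('a, 'b) l2 \<Rightarrow> ('a, 'b) l2 \<Rightarrow> real" where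
  "dist_l2 f g = norm (f - g)"
definition sgn_l2 :: "('a, 'b) l2 \<Rightarrow> ('a, 'b) l2" where
  "sgn_l2 f = inverse (norm f) *\<^sub>R f"
definition uniformity_l2 :: "(('a, 'b) l2 \<times> ('a, 'b) l2) filter" where
  "uniformity_l2 = (INF e\<in>{0<..}. principal {(f, g). dist f g < e})"
definition open_l2 :: "('a, 'b) l2 set \<Rightarrow> bool" where
  "open_l2 U \<longleftrightarrow> (\<forall>f\<in>U. eventually (\<lambda>(f', g). f' = f \<longrightarrow> g \<in> U) uniformity)"

lemma l2_summable_inner:
  "(\<lambda>x. inner (l2_apply f x) (l2_apply g x)) summable_on UNIV"
  using summable_on_Re[OF l2_summable_cinner[OF l2_summable l2_summable, of f g]]
  by (simp add: Re_cinner)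

instance
proof
  fix f g h :: "('a, 'b) l2" and r s :: real
  show "f + g + h = f + (g + h)" by transfer (simp add: add.assoc)
  show "f + g = g + f" by transfer (simp add: add.commute)
  show "0 + f = f" by transfer simp
  show "- f + f = 0" by transfer simp
  show "f - g = f + - g" by transfer simp
  show "r *\<^sub>R (f + g) = r *\<^sub>R f + r *\<^sub>R g" by transfer (simp add: scaleR_add_right)
  show "(r + s) *\<^sub>R f = r *\<^sub>R f + s *\<^sub>R f" by transfer (simp add: scaleR_add_left)
  show "r *\<^sub>R s *\<^sub>R f = (r * s) *\<^sub>R f" by transfer simp
  show "1 *\<^sub>R f = f" by transfer simp
  show "dist f g = norm (f - g)" by (rule dist_l2_def)
  show "sgn f = inverse (norm f) *\<^sub>R f" by (rule sgn_l2_def)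
  show "(uniformity :: (('a, 'b) l2 \<times> ('a, 'b) l2) filter) =
      (INF e\<in>{0<..}. principal {(f, g). dist f g < e})"
    by (rule uniformity_l2_def)
  show "open U \<longleftrightarrow> (\<forall>f\<in>U. eventually (\<lambda>(f', g). f' = f \<longrightarrow> g \<in> U) uniformity)"
    for U :: "('a, 'b) l2 set"
    by (rule open_l2_def)
  show "inner f g = inner g f"
    by (simp add: inner_l2_def inner_commute)
  show "inner (f + g) h = inner f h + inner g h"
    by (simp add: inner_l2_def plus_l2.rep_eq inner_add_left infsum_add l2_summable_inner)
  show "inner (r *\<^sub>R f) g = r * inner f g"
    by (simp add: inner_l2_def scaleR_l2.rep_eq infsum_cmult_right')
  show "0 \<le> inner f f"
    by (simp add: inner_l2_def infsum_nonneg)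
  show "inner f f = 0 \<longleftrightarrow> f = 0"
  proof
    assume "inner f f = 0"
    then have "inner (l2_apply f x) (l2_apply f x) = 0" for x
      using nonneg_infsum_le_0D[of "\<lambda>x. inner (l2_apply f x) (l2_apply f x)" UNIV x]
        l2_summable_inner[of f f]
      by (simp add: inner_l2_def)
    then show "f = 0"
      by (simp add: l2_apply_inject[symmetric] zero_l2.rep_eq fun_eq_iff)
  qed (simp add: inner_l2_def zero_l2.rep_eq)
  show "norm f = sqrt (inner f f)"
    by (simp add: norm_l2_def inner_l2_def power2_norm_eq_inner)
qed

end

lemma norm_l2_apply_sum_le:
  assumes "finite F"
  shows "(\<Sum>x\<in>F. (norm (l2_apply f x))\<^sup>2) \<le> (norm f)\<^sup>2"
  using finite_sum_le_infsum[OF l2_summable[of f] assms]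
  by (simp add: norm_l2_def infsum_nonneg)

lemma norm_l2_apply_le: "norm (l2_apply f x) \<le> norm f"
  using norm_l2_apply_sum_le[of "{x}" f] by (simp add: power2_le_iff_abs_le)

instance l2 :: (type, complex_hilbert) banach
proof
  fix S :: "nat \<Rightarrow> ('a, 'b) l2"
  assume S: "Cauchy S"
  define g where "g x = lim (\<lambda>n. l2_apply (S n) x)" for x
  have g: "(\<lambda>n. l2_apply (S n) x) \<longlonglongrightarrow> g x" for x
  proof -
    have "Cauchy (\<lambda>n. l2_apply (S n) x)"
    proof (rule metric_CauchyI)
      fix e :: real assume "0 < e"
      then obtain M where M: "\<And>m n. m \<ge> M \<Longrightarrow> n \<ge> M \<Longrightarrow> dist (S m) (S n) < e"
        using S by (meson metric_CauchyD)
      show "\<exists>M. \<forall>m\<ge>M. \<forall>n\<ge>M. dist (l2_apply (S m) x) (l2_apply (S n) x) < e"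
      proof (intro exI allI impI)
        fix m n assume "M \<le> m" "M \<le> n"
        then show "dist (l2_apply (S m) x) (l2_apply (S n) x) < e"
          using M[of m n] norm_l2_apply_le[of "S m - S n" x]
          by (simp add: dist_norm minus_l2.rep_eq)
      qed
    qed
    then show ?thesis
      unfolding g_def by (simp add: Cauchy_convergent_iff convergent_LIMSEQ_iff)
  qed
  have bound: "\<exists>M. \<forall>n\<ge>M. \<forall>F. finite F \<longrightarrow> (\<Sum>x\<in>F. (norm (l2_apply (S n) x - g x))\<^sup>2) \<le> e\<^sup>2"
    if "0 < e" for e :: real
  proof -
    obtain M where M: "\<And>m n. m \<ge> M \<Longrightarrow> n \<ge> M \<Longrightarrow> dist (S m) (S n) < e"
      using S \<open>0 < e\<close> by (meson metric_CauchyD)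
    show ?thesis
    proof (intro exI allI impI)
      fix n and F :: "'a set" assume n: "M \<le> n" and F: "finite F"
      have lim: "(\<lambda>m. \<Sum>x\<in>F. (norm (l2_apply (S n) x - l2_apply (S m) x))\<^sup>2)
          \<longlonglongrightarrow> (\<Sum>x\<in>F. (norm (l2_apply (S n) x - g x))\<^sup>2)"
        by (intro tendsto_intros g)
      show "(\<Sum>x\<in>F. (norm (l2_apply (S n) x - g x))\<^sup>2) \<le> e\<^sup>2"
      proof (rule tendsto_upperbound[OF lim])
        show "\<forall>\<^sub>F m in sequentially.
            (\<Sum>x\<in>F. (norm (l2_apply (S n) x - l2_apply (S m) x))\<^sup>2) \<le> e\<^sup>2"
        proof (rule eventually_sequentiallyI[of M])
          fix m assume "M \<le> m"
          then have "(norm (S n - S m))\<^sup>2 \<le> e\<^sup>2"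
            using M[OF n] by (simp add: dist_norm power_mono less_imp_le)
          then show "(\<Sum>x\<in>F. (norm (l2_apply (S n) x - l2_apply (S m) x))\<^sup>2) \<le> e\<^sup>2"
            using norm_l2_apply_sum_le[OF F, of "S n - S m"] by (simp add: minus_l2.rep_eq)
        qed
      qed simp
    qed
  qed
  have diff: "(\<lambda>x. (norm (l2_apply (S n) x - g x))\<^sup>2) summable_on UNIV"
    if "\<And>F. finite F \<Longrightarrow> (\<Sum>x\<in>F. (norm (l2_apply (S n) x - g x))\<^sup>2) \<le> e\<^sup>2" for n and e :: real
    by (rule nonneg_bdd_above_summable_on) (use that in \<open>auto intro!: bdd_aboveI2\<close>)
  obtain M where "\<And>F. finite F \<Longrightarrow> (\<Sum>x\<in>F. (norm (l2_apply (S M) x - g x))\<^sup>2) \<le> 1\<^sup>2"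
    using bound[of 1] by auto
  from l2_summable_add[OF l2_summable[of "S M"] l2_summable_scaleC[OF diff[OF this], of "- 1"]]
  have "(\<lambda>x. (norm (g x))\<^sup>2) summable_on UNIV"
    using scaleC_of_real[of "- 1" "_ :: 'b"] by (simp add: algebra_simps)
  then have G: "l2_apply (Abs_l2 g) = g"
    by (simp add: Abs_l2_inverse)
  have "S \<longlonglongrightarrow> Abs_l2 g"
  proof (rule metric_LIMSEQ_I)
    fix e :: real assume e: "0 < e"
    obtain N where N: "\<And>n F. N \<le> n \<Longrightarrow> finite F \<Longrightarrow>
        (\<Sum>x\<in>F. (norm (l2_apply (S n) x - g x))\<^sup>2) \<le> (e / 2)\<^sup>2"
      using bound[of "e / 2"] e by auto
    show "\<exists>N. \<forall>n\<ge>N. dist (S n) (Abs_l2 g) < e"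
    proof (intro exI allI impI)
      fix n assume "N \<le> n"
      then have "(\<Sum>\<^sub>\<infinity>x. (norm (l2_apply (S n - Abs_l2 g) x))\<^sup>2) \<le> (e / 2)\<^sup>2"
        by (intro infsum_le_finite_sums l2_summable) (simp add: minus_l2.rep_eq G N)
      then have "norm (S n - Abs_l2 g) \<le> e / 2"
        using e unfolding norm_l2_def by (intro real_le_lsqrt) auto
      then show "dist (S n) (Abs_l2 g) < e"
        using e by (simp add: dist_norm)
    qed
  qed
  then show "convergent S"
    by (rule convergentI)
qed

instantiation l2 :: (type, complex_hilbert) complex_hilbert
begin

lift_definition scaleC_l2 :: "complex \<Rightarrow> ('a, 'b) l2 \<Rightarrow> ('a, 'b) l2"
  is "\<lambda>c f x. c *\<^sub>C f x" by (rule l2_summable_scaleC)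

definition cinner_l2 :: "('a, 'b) l2 \<Rightarrow> ('a, 'b) l2 \<Rightarrow> complex" where
  "cinner_l2 f g = (\<Sum>\<^sub>\<infinity>x. cinner (l2_apply f x) (l2_apply g x))"

instance
proof
  fix f g h :: "('a, 'b) l2" and b c :: complex and r :: real
  show "c *\<^sub>C (f + g) = c *\<^sub>C f + c *\<^sub>C g" by transfer (simp add: scaleC_add_right)
  show "(b + c) *\<^sub>C f = b *\<^sub>C f + c *\<^sub>C f" by transfer (simp add: scaleC_add_left)
  show "b *\<^sub>C c *\<^sub>C f = (b * c) *\<^sub>C f" by transfer (simp add: scaleC_scaleC)
  show "complex_of_real r *\<^sub>C f = r *\<^sub>R f" by transfer (simp add: scaleC_of_real)
  show "cinner f g = cnj (cinner g f)"
    unfolding cinner_l2_def infsum_cnj[symmetric] by (simp flip: cinner_commute)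
  show "cinner (f + g) h = cinner f h + cinner g h"
    by (simp add: cinner_l2_def plus_l2.rep_eq cinner_add_left infsum_add l2_summable_cinner
        l2_summable)
  show "cinner (c *\<^sub>C f) g = c * cinner f g"
    by (simp add: cinner_l2_def scaleC_l2.rep_eq cinner_scaleC_left infsum_cmult_right')
  show "Re (cinner f g) = inner f g"
    by (simp add: cinner_l2_def inner_l2_def Re_cinner l2_summable_cinner l2_summable
        flip: infsum_Re)
qed

end

lift_definition l2_single :: "'a \<Rightarrow> 'h \<Rightarrow> ('a, 'h::complex_hilbert) l2"
  is "\<lambda>y v x. if x = y then v else 0"
proof -
  fix y :: 'a and v :: 'h
  have "(\<lambda>x. (norm (if x = y then v else 0))\<^sup>2) summable_on {y}"
    by simp
  then show "(\<lambda>x. (norm (if x = y then v else 0))\<^sup>2) summable_on UNIV"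
    by (rule summable_on_cong_neutral[THEN iffD1, rotated -1]) auto
qed

lemma norm_l2_single: "norm (l2_single y v) = norm v"
proof -
  have "(\<Sum>\<^sub>\<infinity>x. (norm (l2_apply (l2_single y v) x))\<^sup>2) =
      (\<Sum>\<^sub>\<infinity>x\<in>{y}. (norm (l2_apply (l2_single y v) x))\<^sup>2)"
    by (rule infsum_cong_neutral) (auto simp: l2_single.rep_eq)
  then show ?thesis
    by (simp add: norm_l2_def l2_single.rep_eq)
qed

section \<open>Operators on \<open>\<ell>\<^sup>2(X; H\<^sub>0)\<close>\<close>

text \<open>The type \<open>'a \<Rightarrow>\<^sub>L 'b\<close> consists of bounded real-linear maps with the operator norm;
  complex linearity is imposed by \<open>complex_linear\<close>, which cuts out a norm closed subspace.\<close>

definition complex_linear :: "('a::complex_hilbert \<Rightarrow>\<^sub>L 'b::complex_hilbert) \<Rightarrow> bool" where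
  "complex_linear T \<longleftrightarrow> (\<forall>c v. blinfun_apply T (c *\<^sub>C v) = c *\<^sub>C blinfun_apply T v)"

definition compact_operator :: "('a::complex_hilbert \<Rightarrow>\<^sub>L 'b::complex_hilbert) \<Rightarrow> bool" where
  "compact_operator T \<longleftrightarrow> compact (closure (blinfun_apply T ` cball 0 1))"

lift_definition matrix_entry ::
    "(('x, 'h) l2 \<Rightarrow>\<^sub>L ('x, 'h) l2) \<Rightarrow> 'x \<Rightarrow> 'x \<Rightarrow> ('h::complex_hilbert \<Rightarrow>\<^sub>L 'h)"
  is "\<lambda>T x y v. l2_apply (T (l2_single y v)) x"
proof -
  fix T :: "('x, 'h) l2 \<Rightarrow> ('x, 'h) l2" and x y
  assume "bounded_linear T"
  then interpret bounded_linear T .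
  show "bounded_linear (\<lambda>v. l2_apply (T (l2_single y v)) x)"
  proof (rule bounded_linear_intro)
    fix v w :: 'h and r :: real
    have "l2_single y (v + w) = l2_single y v + l2_single y w"
      by transfer auto
    then show "l2_apply (T (l2_single y (v + w))) x =
        l2_apply (T (l2_single y v)) x + l2_apply (T (l2_single y w)) x"
      by (simp add: add plus_l2.rep_eq)
    have "l2_single y (r *\<^sub>R v) = r *\<^sub>R l2_single y v"
      by transfer auto
    then show "l2_apply (T (l2_single y (r *\<^sub>R v))) x = r *\<^sub>R l2_apply (T (l2_single y v)) x"
      by (simp add: scale scaleR_l2.rep_eq)
    have "norm (T (l2_single y v)) \<le> norm v * onorm T"
      using onorm[OF bounded_linear_axioms, of "l2_single y v"]
      by (simp add: norm_l2_single mult.commute)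
    then show "norm (l2_apply (T (l2_single y v)) x) \<le> norm v * onorm T"
      by (rule order_trans[OF norm_l2_apply_le])
  qed
qed

definition finite_propagation ::
    "(('x::metric_space, 'h::complex_hilbert) l2 \<Rightarrow>\<^sub>L ('x, 'h) l2) \<Rightarrow> bool" where
  "finite_propagation T \<longleftrightarrow> bdd_above {dist x y |x y. matrix_entry T x y \<noteq> 0}"

definition locally_compact_operator ::
    "(('x, 'h::complex_hilbert) l2 \<Rightarrow>\<^sub>L ('x, 'h) l2) \<Rightarrow> bool" where
  "locally_compact_operator T \<longleftrightarrow> (\<forall>x y. compact_operator (matrix_entry T x y))"

definition uniform_roe_algebra ::
    "(('x::metric_space, complex) l2 \<Rightarrow>\<^sub>L ('x, complex) l2) set" where
  "uniform_roe_algebra = closure {T. complex_linear T \<and> finite_propagation T}"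

definition roe_algebra ::
    "(('x::metric_space, (nat, complex) l2) l2 \<Rightarrow>\<^sub>L ('x, (nat, complex) l2) l2) set" where
  "roe_algebra =
     closure {T. complex_linear T \<and> finite_propagation T \<and> locally_compact_operator T}"

section \<open>Sparse spaces and measured asymptotic expanders\<close>

text \<open>Throughout, the ambient metric space is a whole type, and the blocks \<open>X n\<close> carry the
  restricted metric.\<close>

definition bounded_geometry :: "'x::metric_space itself \<Rightarrow> bool" where
  "bounded_geometry _ \<longleftrightarrow>
     (\<forall>R>0. \<exists>N. \<forall>x::'x. finite (cball x R) \<and> card (cball x R) \<le> N)"

definition sparse_space :: "(nat \<Rightarrow> 'x::metric_space set) \<Rightarrow> bool" where
  "sparse_space X \<longleftrightarrow>
     (\<Union>n. X n) = UNIV \<and> disjoint_family X \<and> (\<forall>n. finite (X n) \<and> X n \<noteq> {}) \<and>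
     (\<forall>K. \<exists>N. \<forall>n m. n \<noteq> m \<and> N \<le> n + m \<longrightarrow> K \<le> setdist (X n) (X m))"

text \<open>Since \<open>infdist x {} = 0\<close>, the next definition is the intended one only for \<open>A \<noteq> {}\<close>;
  it is used below for sets of positive measure.\<close>

definition boundary_in :: "'x::metric_space set \<Rightarrow> real \<Rightarrow> 'x set \<Rightarrow> 'x set" where
  "boundary_in Y R A = {x \<in> Y - A. infdist x A \<le> R}"

text \<open>A measure on a finite set is given by its point masses.\<close>

definition measured_asymptotic_expanders ::
    "(nat \<Rightarrow> 'x::metric_space set) \<Rightarrow> (nat \<Rightarrow> 'x \<Rightarrow> real) \<Rightarrow> bool" where
  "measured_asymptotic_expanders X m \<longleftrightarrow>
     (\<forall>\<alpha>. 0 < \<alpha> \<and> \<alpha> \<le> 1/2 \<longrightarrow>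
       (\<exists>c R. 0 < c \<and> c < 1 \<and> 0 < R \<and>
         (\<forall>n A. A \<subseteq> X n \<and> \<alpha> \<le> sum (m n) A \<and> sum (m n) A \<le> 1/2 \<longrightarrow>
           sum (m n) (boundary_in (X n) R A) > c * sum (m n) A)))"

section \<open>Block-rank-one projections\<close>

text \<open>\<open>\<ell>\<^sup>2(Y; H\<^sub>0)\<close> is identified with the closed subspace of functions supported in \<open>Y\<close>.\<close>

definition l2_supported :: "'x set \<Rightarrow> ('x, 'h::complex_hilbert) l2 set" where
  "l2_supported Y = {f. \<forall>x. x \<notin> Y \<longrightarrow> l2_apply f x = 0}"

text \<open>\<open>P\<close> restricts to an orthogonal projection of the subspace \<open>V\<close> with one-dimensional range.\<close>

definition rank_one_projection_on ::
    "'a::complex_hilbert set \<Rightarrow> ('a \<Rightarrow>\<^sub>L 'a) \<Rightarrow> bool" where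
  "rank_one_projection_on V P \<longleftrightarrow>
     blinfun_apply P ` V \<subseteq> V \<and>
     (\<forall>f\<in>V. blinfun_apply P (blinfun_apply P f) = blinfun_apply P f) \<and>
     (\<forall>f\<in>V. \<forall>g\<in>V. cinner (blinfun_apply P f) g = cinner f (blinfun_apply P g)) \<and>
     (\<exists>e. e \<noteq> 0 \<and> blinfun_apply P ` V = range (\<lambda>c. c *\<^sub>C e))"

text \<open>As the finitely supported functions are dense, a bounded operator is the direct sum of its
  restrictions to the invariant subspaces \<open>\<ell>\<^sup>2(X n; H\<^sub>0)\<close>.\<close>

definition block_rank_one_projection ::
    "(nat \<Rightarrow> 'x set) \<Rightarrow> (('x, 'h::complex_hilbert) l2 \<Rightarrow>\<^sub>L ('x, 'h) l2) \<Rightarrow> bool" where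
  "block_rank_one_projection X P \<longleftrightarrow>
     complex_linear P \<and> (\<forall>n. rank_one_projection_on (l2_supported (X n)) P)"

text \<open>The unit vectors \<open>\<xi> n\<close> are unique up to a phase, so \<open>m n\<close> is determined on \<open>X n\<close>
  (and vanishes elsewhere).\<close>

definition associated_measure ::
    "(nat \<Rightarrow> 'x set) \<Rightarrow> (('x, 'h::complex_hilbert) l2 \<Rightarrow>\<^sub>L ('x, 'h) l2) \<Rightarrow>
     (nat \<Rightarrow> 'x \<Rightarrow> real) \<Rightarrow> bool" where
  "associated_measure X P m \<longleftrightarrow>
     (\<exists>\<xi>. (\<forall>n. \<xi> n \<in> l2_supported (X n) \<and> norm (\<xi> n) = 1 \<and>
             (\<forall>\<eta>\<in>l2_supported (X n). blinfun_apply P \<eta> = cinner \<eta> (\<xi> n) *\<^sub>C \<xi> n)) \<and>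
          (\<forall>n x. m n x = (norm (l2_apply (\<xi> n) x))\<^sup>2))"

lemma associated_measure_exists:
  assumes "block_rank_one_projection X P"
  shows "\<exists>m. associated_measure X P m"
proof -
  have "\<exists>e. e \<in> l2_supported (X n) \<and> norm e = 1 \<and>
      (\<forall>f\<in>l2_supported (X n). blinfun_apply P f = cinner f e *\<^sub>C e)" for n
  proof -
    let ?V = "l2_supported (X n)"
    have inv: "blinfun_apply P ` ?V \<subseteq> ?V"
      and idem: "\<And>f. f \<in> ?V \<Longrightarrow> blinfun_apply P (blinfun_apply P f) = blinfun_apply P f"
      and adj: "\<And>f g. f \<in> ?V \<Longrightarrow> g \<in> ?V \<Longrightarrow>
        cinner (blinfun_apply P f) g = cinner f (blinfun_apply P g)"
      using assms by (auto simp: block_rank_one_projection_def rank_one_projection_on_def)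
    obtain e0 where e0: "e0 \<noteq> 0" "blinfun_apply P ` ?V = range (\<lambda>c. c *\<^sub>C e0)"
      using assms unfolding block_rank_one_projection_def rank_one_projection_on_def by meson
    define e where "e = complex_of_real (inverse (norm e0)) *\<^sub>C e0"
    have ran: "e \<in> blinfun_apply P ` ?V"
      unfolding e0(2) e_def by blast
    then have eV: "e \<in> ?V" using inv by blast
    have Pe: "blinfun_apply P e = e" using ran idem by auto
    have e1: "norm e = 1" using e0(1) by (simp add: e_def scaleC_of_real del: of_real_inverse)
    have e0e: "e0 = complex_of_real (norm e0) *\<^sub>C e"
      using e0(1) by (simp add: e_def scaleC_of_real del: of_real_inverse)
    have "blinfun_apply P f = cinner f e *\<^sub>C e" if f: "f \<in> ?V" for f
    proof -
      obtain c where "blinfun_apply P f = c *\<^sub>C e0"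
        using f e0(2) by blast
      then have c: "blinfun_apply P f = (c * norm e0) *\<^sub>C e"
        by (subst (asm) e0e) (simp only: scaleC_scaleC)
      then have "c * norm e0 = cinner (blinfun_apply P f) e"
        by (simp add: cinner_scaleC_left cinner_self e1)
      also have "\<dots> = cinner f e" using adj[OF f eV] Pe by simp
      finally show ?thesis using c by simp
    qed
    then show ?thesis using eV e1 by blast
  qed
  then have "\<forall>n. \<exists>e. e \<in> l2_supported (X n) \<and> norm e = 1 \<and>
      (\<forall>f\<in>l2_supported (X n). blinfun_apply P f = cinner f e *\<^sub>C e)" ..
  from choice[OF this] obtain \<xi> where "\<And>n. \<xi> n \<in> l2_supported (X n) \<and> norm (\<xi> n) = 1 \<and>
      (\<forall>f\<in>l2_supported (X n). blinfun_apply P f = cinner f (\<xi> n) *\<^sub>C \<xi> n)"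
    by auto
  then have "associated_measure X P (\<lambda>n x. (norm (l2_apply (\<xi> n) x))\<^sup>2)"
    unfolding associated_measure_def by (intro exI[of _ \<xi>]) simp
  then show ?thesis
    by (rule exI[where x = "\<lambda>n x. (norm (l2_apply (\<xi> n) x))\<^sup>2"])
qed

end

theory Submission
  imports Defs
begin

text \<open>If an operator of propagation at most \<open>R\<close> is close to \<open>P\<close>, then, for \<open>B\<close> at distance more than
  \<open>R\<close> from \<open>A\<close>, the block of \<open>P\<close> between \<open>A\<close> and \<open>B\<close>, whose norm is \<open>sqrt (m A * m B)\<close>, is small; so
  \<open>m B\<close> is small when \<open>m A\<close> is not.

  Conversely, weight the pairs of points at distance at most \<open>R\<close> by \<open>min (m x) (m y)\<close>. Asymptotic
  expansion bounds from below the cuts of all sets of measure in \<open>[\<alpha>, 1 - \<alpha>]\<close>. Deleting from each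
  block a maximal set of measure below \<open>\<alpha>\<close> with a small cut leaves a weighted graph in which all
  sets of at most half the measure expand, so Cheeger's inequality gives a spectral gap, uniform in the block. Powers of the lazy
  random walk have finite propagation and converge uniformly to the averaging projection,
  which differs from \<open>P\<close> by \<open>O(sqrt \<alpha>)\<close>.\<close>

section \<open>Cheeger's inequality\<close>

text \<open>The Dirichlet form of the weighted graph. It runs over ordered pairs, so for symmetric
  \<open>w\<close> each edge counts twice, while \<open>cut\<close> counts each crossing edge once;
  the factors 2 below come from this.\<close>

definition energy :: "'x set \<Rightarrow> ('x \<Rightarrow> 'x \<Rightarrow> real) \<Rightarrow> ('x \<Rightarrow> real) \<Rightarrow> real" where
  "energy Y w f = (\<Sum>x\<in>Y. \<Sum>y\<in>Y. w x y * (f x - f y)\<^sup>2)"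

definition cut :: "'x set \<Rightarrow> ('x \<Rightarrow> 'x \<Rightarrow> real) \<Rightarrow> 'x set \<Rightarrow> real" where
  "cut Y w A = (\<Sum>x\<in>A. \<Sum>y\<in>Y - A. w x y)"

lemma sum_abs_indicator_diff:
  fixes w :: "'x \<Rightarrow> 'x \<Rightarrow> real"
  assumes Y: "finite Y" "A \<subseteq> Y" and sym: "\<And>x y. w x y = w y x"
  shows "(\<Sum>x\<in>Y. \<Sum>y\<in>Y. w x y * \<bar>indicator A x - indicator A y\<bar>) = 2 * cut Y w A"
proof -
  have fin: "finite A" "finite (Y - A)" using Y finite_subset by auto
  have Ysum: "sum g Y = sum g A + sum g (Y - A)" for g :: "'x \<Rightarrow> real"
    by (metis Y sum.subset_diff add.commute)
  have "(\<Sum>x\<in>Y. \<Sum>y\<in>Y. w x y * \<bar>indicator A x - indicator A y\<bar>) =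
      (\<Sum>x\<in>A. \<Sum>y\<in>Y - A. w x y) + (\<Sum>x\<in>Y - A. \<Sum>y\<in>A. w x y)"
    by (simp add: Ysum)
  also have "(\<Sum>x\<in>Y - A. \<Sum>y\<in>A. w x y) = (\<Sum>x\<in>A. \<Sum>y\<in>Y - A. w x y)"
    by (subst sum.swap) (simp add: sym[symmetric])
  finally show ?thesis by (simp add: cut_def)
qed

text \<open>Layer-cake decomposition: \<open>u\<close> is a nonnegative combination of indicators of
  its superlevel sets, all contained in \<open>S\<close>, and both sides are additive along it. The
  induction on the size of the support peels off one layer at a time.\<close>

lemma coarea_inequality:
  fixes w :: "'x \<Rightarrow> 'x \<Rightarrow> real" and m u :: "'x \<Rightarrow> real"
  assumes Y: "finite Y" and sym: "\<And>x y. w x y = w y x"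
    and iso: "\<And>A. A \<subseteq> S \<Longrightarrow> c * sum m A \<le> cut Y w A"
    and S: "S \<subseteq> Y" and u: "\<And>x. x \<in> Y \<Longrightarrow> 0 \<le> u x" "\<And>x. x \<in> Y - S \<Longrightarrow> u x = 0"
  shows "2 * c * (\<Sum>x\<in>Y. m x * u x) \<le> (\<Sum>x\<in>Y. \<Sum>y\<in>Y. w x y * \<bar>u x - u y\<bar>)"
  using u
proof (induction "card {x \<in> Y. u x \<noteq> 0}" arbitrary: u rule: less_induct)
  case less
  define A where "A = {x \<in> Y. u x \<noteq> 0}"
  have finA: "finite A" and AY: "A \<subseteq> Y" and AS: "A \<subseteq> S"
    using Y less.prems by (auto simp: A_def)
  show ?case
  proof (cases "A = {}")
    case True
    then have "u x = 0" if "x \<in> Y" for x using that by (auto simp: A_def)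
    then show ?thesis by simp
  next
    case False
    \<comment> \<open>The smallest positive value: subtracting it on the support keeps the function
      nonnegative and annihilates it at a minimiser, so the support shrinks.\<close>
    define a where "a = Min (u ` A)"
    have a_le: "a \<le> u x" if "x \<in> A" for x
      using finA that by (simp add: a_def)
    have "a \<in> u ` A"
      using Min_in[of "u ` A"] finA False by (simp add: a_def)
    then obtain x0 where x0: "x0 \<in> A" "u x0 = a" by blast
    have "0 < a" using x0 less.prems(1)[of x0] by (auto simp: A_def)
    define v where "v x = u x - a * indicator A x" for x
    have uA: "u x = 0" if "x \<in> Y" "x \<notin> A" for x using that by (auto simp: A_def)
    have v0: "0 \<le> v x" if "x \<in> Y" for x
      using a_le[of x] uA[OF that] by (auto simp: v_def indicator_def)
    have "{x \<in> Y. v x \<noteq> 0} \<subseteq> A - {x0}"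
      using uA x0 by (auto simp: v_def indicator_def split: if_splits)
    then have "card {x \<in> Y. v x \<noteq> 0} < card A"
      using finA x0(1) by (meson card_Diff1_less card_mono finite_Diff le_less_trans)
    then have IH: "2 * c * (\<Sum>x\<in>Y. m x * v x) \<le> (\<Sum>x\<in>Y. \<Sum>y\<in>Y. w x y * \<bar>v x - v y\<bar>)"
      using less.hyps[of v] v0 less.prems(2) AS by (auto simp: v_def A_def indicator_def)
    have "(\<Sum>x\<in>Y. m x * indicator A x) = sum m A"
      using AY Y by (simp add: indicator_def if_distrib sum.If_cases Int_absorb1 cong: if_cong)
    then have m: "(\<Sum>x\<in>Y. m x * u x) = (\<Sum>x\<in>Y. m x * v x) + a * sum m A"
      by (simp add: v_def algebra_simps sum_subtractf flip: sum_distrib_left)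
    \<comment> \<open>The variation splits without cancellation, because inside \<open>Y\<close> the
      remainder \<open>v\<close> is nonnegative on \<open>A\<close> and zero off it.\<close>
    have abs: "\<bar>u x - u y\<bar> = \<bar>v x - v y\<bar> + a * \<bar>indicator A x - indicator A y\<bar>"
      if "x \<in> Y" "y \<in> Y" for x y
      using a_le[of x] a_le[of y] uA[of x] uA[of y] that \<open>0 < a\<close>
      by (cases "x \<in> A"; cases "y \<in> A") (auto simp: v_def)
    have "(\<Sum>x\<in>Y. \<Sum>y\<in>Y. w x y * \<bar>u x - u y\<bar>) = (\<Sum>x\<in>Y. \<Sum>y\<in>Y. w x y * \<bar>v x - v y\<bar>) +
        a * (\<Sum>x\<in>Y. \<Sum>y\<in>Y. w x y * \<bar>indicator A x - indicator A y\<bar>)"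
      by (simp add: abs algebra_simps sum.distrib sum_distrib_left cong: sum.cong)
    also have "\<dots> = (\<Sum>x\<in>Y. \<Sum>y\<in>Y. w x y * \<bar>v x - v y\<bar>) + 2 * (a * cut Y w A)"
      by (subst sum_abs_indicator_diff[OF Y AY sym]) simp
    moreover have "a * (c * sum m A) \<le> a * cut Y w A"
      using \<open>0 < a\<close> iso[OF AS] by simp
    ultimately show ?thesis using IH m by (simp add: algebra_simps)
  qed
qed

text \<open>Apply the coarea inequality to the square of \<open>g\<close>, factor the difference of
  squares, and use Cauchy-Schwarz over pairs: the differences give the energy, and the sums are
  controlled by the degree bound. One factor \<open>G\<close> then cancels.\<close>

lemma cheeger_inequality_nonneg:
  fixes w :: "'x \<Rightarrow> 'x \<Rightarrow> real" and m g :: "'x \<Rightarrow> real"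
  assumes Y: "finite Y" and sym: "\<And>x y. w x y = w y x" and w: "\<And>x y. 0 \<le> w x y"
    and deg: "\<And>x. x \<in> Y \<Longrightarrow> (\<Sum>y\<in>Y. w x y) \<le> N * m x" and m: "\<And>x. x \<in> Y \<Longrightarrow> 0 \<le> m x"
    and iso: "\<And>A. A \<subseteq> S \<Longrightarrow> c * sum m A \<le> cut Y w A" and c: "0 \<le> c" and N: "0 \<le> N"
    and S: "S \<subseteq> Y" and g: "\<And>x. x \<in> Y \<Longrightarrow> 0 \<le> g x" "\<And>x. x \<in> Y - S \<Longrightarrow> g x = 0"
  shows "c\<^sup>2 * (\<Sum>x\<in>Y. m x * (g x)\<^sup>2) \<le> N * energy Y w g"
proof -
  define G where "G = (\<Sum>x\<in>Y. m x * (g x)\<^sup>2)"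
  have G0: "0 \<le> G" unfolding G_def using m by (intro sum_nonneg) auto
  have "2 * c * G \<le> (\<Sum>x\<in>Y. \<Sum>y\<in>Y. w x y * \<bar>(g x)\<^sup>2 - (g y)\<^sup>2\<bar>)"
    unfolding G_def using coarea_inequality[OF Y sym iso S, where u = "\<lambda>x. (g x)\<^sup>2"] g by simp
  also have "\<dots> = (\<Sum>p\<in>Y \<times> Y. (sqrt (w (fst p) (snd p)) * \<bar>g (fst p) - g (snd p)\<bar>) *
      (sqrt (w (fst p) (snd p)) * (g (fst p) + g (snd p))))"
    unfolding sum.cartesian_product
  proof (rule sum.cong[OF refl], clarsimp)
    fix x y assume "x \<in> Y" "y \<in> Y"
    then have "\<bar>(g x)\<^sup>2 - (g y)\<^sup>2\<bar> = \<bar>g x - g y\<bar> * (g x + g y)"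
      using g(1)[of x] g(1)[of y] by (simp add: power2_eq_square square_diff_square_factored abs_mult)
    then show "w x y * \<bar>(g x)\<^sup>2 - (g y)\<^sup>2\<bar> =
        sqrt (w x y) * \<bar>g x - g y\<bar> * (sqrt (w x y) * (g x + g y))"
      using w[of x y] by (metis (no_types, lifting) mult.assoc mult.left_commute real_sqrt_mult_self abs_of_nonneg)
  qed
  finally have "(2 * c * G)\<^sup>2 \<le> (\<Sum>p\<in>Y \<times> Y. (sqrt (w (fst p) (snd p)) * \<bar>g (fst p) - g (snd p)\<bar>) *
      (sqrt (w (fst p) (snd p)) * (g (fst p) + g (snd p))))\<^sup>2"
    using c G0 by (intro power_mono) auto
  also have "\<dots> \<le> (\<Sum>p\<in>Y \<times> Y. (sqrt (w (fst p) (snd p)) * \<bar>g (fst p) - g (snd p)\<bar>)\<^sup>2) *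
      (\<Sum>p\<in>Y \<times> Y. (sqrt (w (fst p) (snd p)) * (g (fst p) + g (snd p)))\<^sup>2)"
    by (rule Cauchy_Schwarz_ineq_sum)
  also have "(\<Sum>p\<in>Y \<times> Y. (sqrt (w (fst p) (snd p)) * \<bar>g (fst p) - g (snd p)\<bar>)\<^sup>2) = energy Y w g"
    using w by (simp add: energy_def sum.cartesian_product power_mult_distrib case_prod_unfold)
  also have "(\<Sum>p\<in>Y \<times> Y. (sqrt (w (fst p) (snd p)) * (g (fst p) + g (snd p)))\<^sup>2) =
      (\<Sum>x\<in>Y. \<Sum>y\<in>Y. w x y * (g x + g y)\<^sup>2)"
    using w by (simp add: sum.cartesian_product power_mult_distrib case_prod_unfold)
  also have "energy Y w g * (\<Sum>x\<in>Y. \<Sum>y\<in>Y. w x y * (g x + g y)\<^sup>2) \<le> energy Y w g * (4 * (N * G))"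
  proof (rule mult_left_mono)
    have "(\<Sum>x\<in>Y. \<Sum>y\<in>Y. w x y * (g x + g y)\<^sup>2) \<le>
        (\<Sum>x\<in>Y. \<Sum>y\<in>Y. w x y * (2 * (g x)\<^sup>2 + 2 * (g y)\<^sup>2))"
    proof (intro sum_mono mult_left_mono w)
      fix x y
      show "(g x + g y)\<^sup>2 \<le> 2 * (g x)\<^sup>2 + 2 * (g y)\<^sup>2"
        using sum_squares_bound[of "g x" "g y"] by (simp add: power2_sum)
    qed
    also have "\<dots> = 2 * (\<Sum>x\<in>Y. \<Sum>y\<in>Y. w x y * (g x)\<^sup>2) + 2 * (\<Sum>x\<in>Y. \<Sum>y\<in>Y. w x y * (g y)\<^sup>2)"
      by (simp add: algebra_simps sum.distrib sum_distrib_left)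
    also have "(\<Sum>x\<in>Y. \<Sum>y\<in>Y. w x y * (g y)\<^sup>2) = (\<Sum>x\<in>Y. \<Sum>y\<in>Y. w x y * (g x)\<^sup>2)"
      by (subst sum.swap) (simp add: sym[symmetric])
    also have "(\<Sum>x\<in>Y. \<Sum>y\<in>Y. w x y * (g x)\<^sup>2) \<le> N * G"
    proof -
      have "(\<Sum>x\<in>Y. \<Sum>y\<in>Y. w x y * (g x)\<^sup>2) = (\<Sum>x\<in>Y. (\<Sum>y\<in>Y. w x y) * (g x)\<^sup>2)"
        by (simp add: sum_distrib_right)
      also have "\<dots> \<le> (\<Sum>x\<in>Y. N * m x * (g x)\<^sup>2)"
        by (intro sum_mono mult_right_mono deg) auto
      finally show ?thesis by (simp add: G_def sum_distrib_left mult.assoc)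
    qed
    finally show "(\<Sum>x\<in>Y. \<Sum>y\<in>Y. w x y * (g x + g y)\<^sup>2) \<le> 4 * (N * G)" by (simp add: mult.commute)
    show "0 \<le> energy Y w g" unfolding energy_def using w by (intro sum_nonneg) auto
  qed
  finally have *: "G * (c\<^sup>2 * G) \<le> G * (N * energy Y w g)"
    by (simp add: power2_eq_square algebra_simps)
  show ?thesis
  proof (cases "G = 0")
    case True
    have "0 \<le> N * energy Y w g"
      using w N unfolding energy_def by (intro mult_nonneg_nonneg sum_nonneg) auto
    then show ?thesis using True by (simp add: G_def)
  next
    case False
    then have "0 < G" using G0 by simp
    from mult_left_le_imp_le[OF * this] show ?thesis by (simp add: G_def)
  qed
qed

text \<open>A median can be taken among the values of \<open>f\<close>: the least one with at most
  half of the mass strictly above it.\<close>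

lemma exists_weighted_median:
  fixes m f :: "'x \<Rightarrow> real"
  assumes Y: "finite Y" "Y \<noteq> {}" and m: "\<And>x. x \<in> Y \<Longrightarrow> 0 \<le> m x"
  shows "\<exists>t. 2 * sum m {x \<in> Y. t < f x} \<le> sum m Y \<and> 2 * sum m {x \<in> Y. f x < t} \<le> sum m Y"
proof -
  define T where "T = {x \<in> Y. 2 * sum m {y \<in> Y. f x < f y} \<le> sum m Y}"
  obtain x1 where x1: "x1 \<in> Y" "\<And>y. y \<in> Y \<Longrightarrow> f y \<le> f x1"
    using Max_in[of "f ` Y"] Max_ge[of "f ` Y"] Y by (metis (no_types, lifting) finite_imageI imageE imageI image_is_empty)
  have "{y \<in> Y. f x1 < f y} = {}" using x1(2) by fastforce
  then have "x1 \<in> T" using x1(1) sum_nonneg[of Y m] m unfolding T_def by (simp only: mem_Collect_eq) simp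
  moreover have finT: "finite T" using Y by (simp add: T_def)
  ultimately obtain x0 where x0: "x0 \<in> T" "\<And>y. y \<in> T \<Longrightarrow> f x0 \<le> f y"
    using Min_in[of "f ` T"] Min_le[of "f ` T"] by (metis (no_types, lifting) empty_iff finite_imageI imageE imageI image_is_empty)
  have "2 * sum m {x \<in> Y. f x < f x0} \<le> sum m Y"
  proof (cases "{x \<in> Y. f x < f x0} = {}")
    case True
    then show ?thesis using sum_nonneg[of Y m] m by (simp only: True) simp
  next
    case False
    define L where "L = {x \<in> Y. f x < f x0}"
    have L: "finite L" "L \<noteq> {}" using Y False by (auto simp: L_def)
    obtain z where z: "z \<in> L" "\<And>y. y \<in> L \<Longrightarrow> f y \<le> f z"
      using Max_in[of "f ` L"] Max_ge[of "f ` L"] L by (metis (no_types, lifting) finite_imageI imageE imageI image_is_empty)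
    \<comment> \<open>\<open>f z\<close> is the next value below \<open>f x0\<close>; by minimality
      more than half of the mass lies above it, and \<open>L\<close> lies in the complement of that
      part.\<close>
    have "z \<notin> T" using x0(2)[of z] z(1) by (auto simp: L_def)
    then have big: "sum m Y < 2 * sum m {y \<in> Y. f z < f y}"
      using z(1) by (auto simp: T_def L_def)
    have "L \<subseteq> Y - {y \<in> Y. f z < f y}" using z(2) by (fastforce simp: L_def)
    then have "sum m L \<le> sum m (Y - {y \<in> Y. f z < f y})"
      using Y m by (intro sum_mono2) auto
    also have "\<dots> = sum m Y - sum m {y \<in> Y. f z < f y}"
      using Y by (intro sum_diff) auto
    finally show ?thesis using big by (simp add: L_def)
  qed
  then show ?thesis using x0(1) by (intro exI[of _ "f x0"]) (simp add: T_def)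
qed

lemma sum_weighted_square_diff_const:
  fixes m f :: "'x \<Rightarrow> real"
  shows "(\<Sum>x\<in>Y. m x * (f x - t)\<^sup>2) =
    (\<Sum>x\<in>Y. m x * (f x)\<^sup>2) - 2 * t * (\<Sum>x\<in>Y. m x * f x) + t\<^sup>2 * sum m Y"
proof -
  have "m x * (f x - t)\<^sup>2 = m x * (f x)\<^sup>2 - 2 * t * (m x * f x) + t\<^sup>2 * m x" for x
    by (simp add: power2_eq_square algebra_simps)
  then show ?thesis
    by (simp only: sum.distrib sum_subtractf sum_distrib_left)
qed

text \<open>Cut \<open>f\<close> at a median instead of its mean: the positive and negative parts of
  \<open>f - t\<close> are each supported on at most half of the mass, so the nonnegative case
  applies to both. Mean zero ensures that shifting by \<open>t\<close> cannot decrease the second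
  moment.\<close>

lemma cheeger_inequality:
  fixes w :: "'x \<Rightarrow> 'x \<Rightarrow> real" and m f :: "'x \<Rightarrow> real"
  assumes Y: "finite Y" and sym: "\<And>x y. w x y = w y x" and w: "\<And>x y. 0 \<le> w x y"
    and deg: "\<And>x. x \<in> Y \<Longrightarrow> (\<Sum>y\<in>Y. w x y) \<le> N * m x" and m: "\<And>x. x \<in> Y \<Longrightarrow> 0 \<le> m x"
    and iso: "\<And>A. A \<subseteq> Y \<Longrightarrow> 2 * sum m A \<le> sum m Y \<Longrightarrow> c * sum m A \<le> cut Y w A"
    and c: "0 \<le> c" and N: "0 \<le> N" and mean: "(\<Sum>x\<in>Y. m x * f x) = 0"
  shows "c\<^sup>2 * (\<Sum>x\<in>Y. m x * (f x)\<^sup>2) \<le> N * energy Y w f"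
proof (cases "Y = {}")
  case False
  obtain t where t: "2 * sum m {x \<in> Y. t < f x} \<le> sum m Y" "2 * sum m {x \<in> Y. f x < t} \<le> sum m Y"
    using exists_weighted_median[of Y m f] Y False m by blast
  have half: "c * sum m A \<le> cut Y w A" if "A \<subseteq> S" "S \<subseteq> Y" "2 * sum m S \<le> sum m Y" for A S
  proof -
    have "sum m A \<le> sum m S" using that Y m by (intro sum_mono2) (auto intro: finite_subset)
    then show ?thesis using that by (intro iso) auto
  qed
  define p where "p x = max (f x - t) 0" for x
  define n where "n x = max (t - f x) 0" for x
  have p: "c\<^sup>2 * (\<Sum>x\<in>Y. m x * (p x)\<^sup>2) \<le> N * energy Y w p"
    by (rule cheeger_inequality_nonneg[OF Y sym w deg m, where S = "{x \<in> Y. t < f x}"])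
       (use t c N half in \<open>auto simp: p_def\<close>)
  have n: "c\<^sup>2 * (\<Sum>x\<in>Y. m x * (n x)\<^sup>2) \<le> N * energy Y w n"
    by (rule cheeger_inequality_nonneg[OF Y sym w deg m, where S = "{x \<in> Y. f x < t}"])
       (use t c N half in \<open>auto simp: n_def\<close>)
  have "energy Y w p + energy Y w n \<le> energy Y w f"
    unfolding energy_def sum.distrib[symmetric]
  proof (intro sum_mono)
    fix x y
    have "(p x - p y)\<^sup>2 + (n x - n y)\<^sup>2 \<le> (f x - f y)\<^sup>2"
    proof -
      \<comment> \<open>\<open>p\<close> is nondecreasing and \<open>n\<close> nonincreasing in the
        value of \<open>f\<close>, so the cross term of the square has the favourable sign.\<close>
      have eq: "f x - f y = (p x - p y) - (n x - n y)" and "(p x - p y) * (n x - n y) \<le> 0"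
        by (auto simp: p_def n_def max_def mult_le_0_iff)
      then show ?thesis unfolding eq by (simp only: power2_diff[of "p x - p y" "n x - n y"])
    qed
    then show "w x y * (p x - p y)\<^sup>2 + w x y * (n x - n y)\<^sup>2 \<le> w x y * (f x - f y)\<^sup>2"
      using w[of x y] by (metis distrib_left mult_left_mono)
  qed
  then have "N * energy Y w p + N * energy Y w n \<le> N * energy Y w f"
    using N by (metis distrib_left mult_left_mono)
  moreover have "(\<Sum>x\<in>Y. m x * (f x)\<^sup>2) \<le> (\<Sum>x\<in>Y. m x * (p x)\<^sup>2) + (\<Sum>x\<in>Y. m x * (n x)\<^sup>2)"
  proof -
    have "(p x)\<^sup>2 + (n x)\<^sup>2 = (f x - t)\<^sup>2" for x
      by (auto simp: p_def n_def max_def power2_commute)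
    then have "(\<Sum>x\<in>Y. m x * (p x)\<^sup>2) + (\<Sum>x\<in>Y. m x * (n x)\<^sup>2) = (\<Sum>x\<in>Y. m x * (f x - t)\<^sup>2)"
      by (simp flip: sum.distrib distrib_left)
    also have "\<dots> = (\<Sum>x\<in>Y. m x * (f x)\<^sup>2) + t\<^sup>2 * sum m Y"
      by (simp add: sum_weighted_square_diff_const mean)
    finally show ?thesis
      using sum_nonneg[of Y m] m by simp
  qed
  then have "c\<^sup>2 * (\<Sum>x\<in>Y. m x * (f x)\<^sup>2) \<le>
      c\<^sup>2 * ((\<Sum>x\<in>Y. m x * (p x)\<^sup>2) + (\<Sum>x\<in>Y. m x * (n x)\<^sup>2))"
    by (intro mult_left_mono) auto
  ultimately show ?thesis using p n by (simp add: distrib_left)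
qed (simp add: energy_def)


section \<open>Lazy random walks on expanding subsets\<close>

text \<open>If some \<open>A\<close> in the rest violated the bound, adding it to a maximal
  \<open>F\<close> would again give a cut of at most \<open>c\<close> times the mass. Maximality
  makes the union heavy, and there \<open>mid\<close> forces a cut of at least \<kappa>, more than
  \<open>c\<close>.\<close>

lemma exists_expanding_subset:
  fixes w :: "'x \<Rightarrow> 'x \<Rightarrow> real" and m :: "'x \<Rightarrow> real"
  assumes X: "finite X" and w: "\<And>x y. 0 \<le> w x y" and m: "\<And>x. x \<in> X \<Longrightarrow> 0 \<le> m x"
    and total: "sum m X = 1" and \<alpha>: "0 < \<alpha>" "\<alpha> \<le> 1/4" and c: "0 \<le> c" "c < \<kappa>"
    and mid: "\<And>A. A \<subseteq> X \<Longrightarrow> \<alpha> \<le> sum m A \<Longrightarrow> sum m A \<le> 1 - \<alpha> \<Longrightarrow> \<kappa> \<le> cut X w A"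
  shows "\<exists>F\<subseteq>X. sum m F < \<alpha> \<and>
    (\<forall>A\<subseteq>X - F. 2 * sum m A \<le> sum m (X - F) \<longrightarrow> c * sum m A \<le> cut (X - F) w A)"
proof -
  define \<F> where "\<F> = {F. F \<subseteq> X \<and> sum m F < \<alpha> \<and> cut X w F \<le> c * sum m F}"
  have "finite \<F>" by (rule finite_subset[of _ "Pow X"]) (use X in \<open>auto simp: \<F>_def\<close>)
  moreover have "{} \<in> \<F>" using \<alpha> by (simp add: \<F>_def cut_def)
  ultimately obtain F where F: "F \<in> \<F>" and max: "\<And>B. B \<in> \<F> \<Longrightarrow> F \<subseteq> B \<Longrightarrow> F = B"
    using finite_has_maximal[of \<F>] by blast
  have FX: "F \<subseteq> X" and Fm: "sum m F < \<alpha>" and Fcut: "cut X w F \<le> c * sum m F"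
    using F by (auto simp: \<F>_def)
  have "c * sum m A \<le> cut (X - F) w A" if A: "A \<subseteq> X - F" "2 * sum m A \<le> sum m (X - F)" for A
  proof (rule ccontr)
    assume small: "\<not> c * sum m A \<le> cut (X - F) w A"
    have fin: "finite F" "finite A" and disj: "F \<inter> A = {}" and FA: "F \<union> A \<subseteq> X"
      using FX A(1) X by (auto intro: finite_subset)
    have mFA: "sum m (F \<union> A) = sum m F + sum m A"
      by (rule sum.union_disjoint[OF fin disj])
    \<comment> \<open>Edges leaving the union either start in \<open>F\<close>, and then also leave
      \<open>F\<close>, or start in \<open>A\<close> and stay inside \<open>X - F\<close>.\<close>
    have "cut X w (F \<union> A) = (\<Sum>x\<in>F. \<Sum>y\<in>X - (F \<union> A). w x y) + cut (X - F) w A"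
      unfolding cut_def by (subst sum.union_disjoint[OF fin disj]) (simp add: Diff_Un Diff_Diff_Int set_diff_eq conj_ac)
    also have "(\<Sum>x\<in>F. \<Sum>y\<in>X - (F \<union> A). w x y) \<le> cut X w F"
      unfolding cut_def using X w by (intro sum_mono sum_mono2) auto
    finally have cutFA: "cut X w (F \<union> A) \<le> c * sum m (F \<union> A)"
      using Fcut small by (simp add: mFA algebra_simps)
    have le1: "sum m (F \<union> A) \<le> 1"
      using sum_mono2[OF X FA, of m] m total by simp
    show False
    proof (cases "\<alpha> \<le> sum m (F \<union> A)")
      case True
      have "sum m (X - F) \<le> 1"
        using sum_mono2[OF X, of "X - F" m] m total by simp
      \<comment> \<open>\<open>A\<close> has mass at most 1/2 and \<open>F\<close> less than
        \<alpha>; their sum is below 1 - \<alpha> because \<alpha> is at most 1/4.\<close>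
      then have "sum m (F \<union> A) \<le> 1 - \<alpha>" using mFA A(2) Fm \<alpha> by simp
      then have "\<kappa> \<le> c * sum m (F \<union> A)" using mid[OF FA True] cutFA by simp
      also have "\<dots> \<le> c" using le1 c(1) by (simp add: mult_left_le)
      finally show False using c by simp
    next
      case False
      then have "F = F \<union> A" using cutFA FA by (intro max) (auto simp: \<F>_def)
      then have "A = {}" using disj by blast
      then show False using small by (simp add: cut_def)
    qed
  qed
  then show ?thesis using FX Fm by blast
qed

section \<open>Contraction of the lazy random walk\<close>

lemma weighted_Cauchy_Schwarz:
  fixes m f :: "'x \<Rightarrow> real"
  assumes "\<And>x. x \<in> Y \<Longrightarrow> 0 \<le> m x"
  shows "(\<Sum>x\<in>Y. m x * f x)\<^sup>2 \<le> sum m Y * (\<Sum>x\<in>Y. m x * (f x)\<^sup>2)"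
proof -
  have "(\<Sum>x\<in>Y. m x * f x) = (\<Sum>x\<in>Y. sqrt (m x) * (sqrt (m x) * f x))"
    using assms by (intro sum.cong) (auto simp flip: mult.assoc)
  also have "\<dots>\<^sup>2 \<le> (\<Sum>x\<in>Y. (sqrt (m x))\<^sup>2) * (\<Sum>x\<in>Y. (sqrt (m x) * f x)\<^sup>2)"
    by (rule Cauchy_Schwarz_ineq_sum)
  also have "\<dots> = sum m Y * (\<Sum>x\<in>Y. m x * (f x)\<^sup>2)"
    using assms by (simp add: power_mult_distrib cong: sum.cong)
  finally show ?thesis .
qed

text \<open>One step of the walk that jumps from \<open>x\<close> to \<open>y\<close> with
  probability \<open>w x y / (2 * N * m x)\<close> and otherwise stays. If the degree at
  \<open>x\<close> is at most \<open>N * m x\<close>, it stays with probability at least 1/2. For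
  symmetric \<open>w\<close> it is reversible with respect to \<open>m\<close>.\<close>

definition lazy_step :: "'x set \<Rightarrow> ('x \<Rightarrow> 'x \<Rightarrow> real) \<Rightarrow> ('x \<Rightarrow> real) \<Rightarrow> real \<Rightarrow> ('x \<Rightarrow> real) \<Rightarrow> 'x \<Rightarrow> real"
  where "lazy_step Y w m N f x = f x - (\<Sum>y\<in>Y. w x y * (f x - f y)) / (2 * N * m x)"

lemma lazy_step_sum:
  "lazy_step Y w m N (\<lambda>x. \<Sum>i\<in>I. a i * f i x) = (\<lambda>x. \<Sum>i\<in>I. a i * lazy_step Y w m N (f i) x)"
proof
  fix x
  have "(\<Sum>y\<in>Y. w x y * ((\<Sum>i\<in>I. a i * f i x) - (\<Sum>i\<in>I. a i * f i y))) =
      (\<Sum>y\<in>Y. \<Sum>i\<in>I. a i * (w x y * (f i x - f i y)))"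
    by (simp add: sum_distrib_left right_diff_distrib sum_subtractf mult_ac)
  also have "\<dots> = (\<Sum>i\<in>I. a i * (\<Sum>y\<in>Y. w x y * (f i x - f i y)))"
    by (subst sum.swap) (simp add: sum_distrib_left)
  finally show "lazy_step Y w m N (\<lambda>x. \<Sum>i\<in>I. a i * f i x) x =
      (\<Sum>i\<in>I. a i * lazy_step Y w m N (f i) x)"
    by (simp only: lazy_step_def right_diff_distrib[of "a _"] sum_subtractf times_divide_eq_right
        sum_divide_distrib[of _ I])
qed

lemma lazy_step_funpow_sum:
  "(lazy_step Y w m N ^^ j) (\<lambda>x. \<Sum>i\<in>I. a i * f i x) =
    (\<lambda>x. \<Sum>i\<in>I. a i * (lazy_step Y w m N ^^ j) (f i) x)"
  by (induction j) (simp_all add: lazy_step_sum)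

lemma lazy_step_funpow_add_const:
  "(lazy_step Y w m N ^^ j) (\<lambda>x. f x + a) = (\<lambda>x. (lazy_step Y w m N ^^ j) f x + a)"
proof (induction j)
  case (Suc j)
  have "lazy_step Y w m N (\<lambda>x. g x + a) = (\<lambda>x. lazy_step Y w m N g x + a)" for g
    by (simp add: lazy_step_def fun_eq_iff)
  then show ?case by (simp add: Suc)
qed simp

text \<open>A step only looks at the current point and its neighbours in \<open>w\<close>, so it
  enlarges the support by at most \<open>R\<close>.\<close>

lemma lazy_step_funpow_local:
  fixes y :: "'x::metric_space"
  assumes "\<And>x y. w x y \<noteq> 0 \<Longrightarrow> dist x y \<le> R" "0 \<le> R" and "\<And>x. x \<noteq> y \<Longrightarrow> f x = 0"
  shows "(lazy_step Y w m N ^^ j) f x \<noteq> 0 \<Longrightarrow> dist x y \<le> real j * R"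
proof (induction j arbitrary: x)
  case 0
  then show ?case using assms(3)[of x] by fastforce
next
  case (Suc j)
  let ?f = "(lazy_step Y w m N ^^ j) f"
  have "?f x \<noteq> 0 \<or> (\<exists>z\<in>Y. w x z \<noteq> 0 \<and> ?f z \<noteq> 0)"
  proof (rule ccontr)
    assume "\<not> ?thesis"
    then have "?f x = 0" "(\<Sum>z\<in>Y. w x z * (?f x - ?f z)) = 0"
      by (auto intro!: sum.neutral)
    then show False using Suc.prems unfolding funpow.simps o_apply lazy_step_def[of Y w m N ?f] by simp
  qed
  then show ?case
  proof
    assume "?f x \<noteq> 0"
    from Suc.IH[OF this] show ?thesis using assms(2) by (simp add: algebra_simps)
  next
    assume "\<exists>z\<in>Y. w x z \<noteq> 0 \<and> ?f z \<noteq> 0"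
    then obtain z where "w x z \<noteq> 0" "?f z \<noteq> 0" by blast
    then show ?thesis using Suc.IH[of z] assms(1)[of x z] dist_triangle[of x y z]
      by (simp add: algebra_simps)
  qed
qed

text \<open>Reversibility: \<open>m x\<close> cancels the denominator, and the double sum of the
  antisymmetric \<open>w x y * (f x - f y)\<close> vanishes.\<close>

lemma sum_lazy_step:
  fixes w :: "'x \<Rightarrow> 'x \<Rightarrow> real"
  assumes sym: "\<And>x y. w x y = w y x" and m: "\<And>x. x \<in> Y \<Longrightarrow> 0 < m x"
  shows "(\<Sum>x\<in>Y. m x * lazy_step Y w m N f x) = (\<Sum>x\<in>Y. m x * f x)"
proof -
  have "(\<Sum>x\<in>Y. m x * lazy_step Y w m N f x) =
      (\<Sum>x\<in>Y. m x * f x - (\<Sum>y\<in>Y. w x y * (f x - f y)) / (2 * N))"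
    by (intro sum.cong) (use m in \<open>auto simp: lazy_step_def right_diff_distrib dest: less_imp_neq[symmetric]\<close>)
  also have "\<dots> = (\<Sum>x\<in>Y. m x * f x) - (\<Sum>x\<in>Y. \<Sum>y\<in>Y. w x y * (f x - f y)) / (2 * N)"
    by (simp add: sum_subtractf sum_divide_distrib)
  also have "(\<Sum>x\<in>Y. \<Sum>y\<in>Y. w x y * (f x - f y)) =
      (\<Sum>x\<in>Y. \<Sum>y\<in>Y. w x y * f x) - (\<Sum>x\<in>Y. \<Sum>y\<in>Y. w x y * f y)"
    by (simp add: right_diff_distrib sum_subtractf)
  also have "(\<Sum>x\<in>Y. \<Sum>y\<in>Y. w x y * f y) = (\<Sum>x\<in>Y. \<Sum>y\<in>Y. w x y * f x)"
    by (subst sum.swap) (simp add: sym[symmetric])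
  finally show ?thesis by simp
qed

text \<open>After expanding the square, the term linear in the Laplacian loses
  \<open>energy Y w f / (2 * N)\<close>, and Cauchy-Schwarz with the degree bound shows that the
  quadratic term gives back at most half of that. The factor 2 in the step size is what leaves this
  surplus.\<close>

lemma lazy_step_energy:
  fixes w :: "'x \<Rightarrow> 'x \<Rightarrow> real"
  assumes Y: "finite Y" and sym: "\<And>x y. w x y = w y x" and w: "\<And>x y. 0 \<le> w x y"
    and deg: "\<And>x. x \<in> Y \<Longrightarrow> (\<Sum>y\<in>Y. w x y) \<le> N * m x" and m: "\<And>x. x \<in> Y \<Longrightarrow> 0 < m x"
    and N: "0 < N"
  shows "(\<Sum>x\<in>Y. m x * (lazy_step Y w m N f x)\<^sup>2) \<le> (\<Sum>x\<in>Y. m x * (f x)\<^sup>2) - energy Y w f / (4 * N)"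
proof -
  define L where "L x = (\<Sum>y\<in>Y. w x y * (f x - f y))" for x
  have cs: "(L x)\<^sup>2 / m x \<le> N * (\<Sum>y\<in>Y. w x y * (f x - f y)\<^sup>2)" if x: "x \<in> Y" for x
  proof -
    have "(L x)\<^sup>2 \<le> (\<Sum>y\<in>Y. w x y) * (\<Sum>y\<in>Y. w x y * (f x - f y)\<^sup>2)"
      unfolding L_def by (rule weighted_Cauchy_Schwarz) (simp add: w)
    also have "\<dots> \<le> N * m x * (\<Sum>y\<in>Y. w x y * (f x - f y)\<^sup>2)"
      using w by (intro mult_right_mono deg x sum_nonneg) auto
    finally show ?thesis using m[OF x] by (simp add: divide_simps mult_ac)
  qed
  \<comment> \<open>Summation by parts: exchanging \<open>x\<close> and \<open>y\<close> and adding
    the two forms gives the full energy.\<close>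
  have fL: "(\<Sum>x\<in>Y. f x * L x) = energy Y w f / 2"
  proof -
    have "(\<Sum>x\<in>Y. f x * L x) = (\<Sum>x\<in>Y. \<Sum>y\<in>Y. w x y * (f x * (f x - f y)))"
      by (simp add: L_def sum_distrib_left mult_ac)
    moreover have "(\<Sum>x\<in>Y. \<Sum>y\<in>Y. w x y * (f x * (f x - f y))) =
        (\<Sum>x\<in>Y. \<Sum>y\<in>Y. w x y * (f y * (f y - f x)))"
      by (subst sum.swap) (simp add: sym[symmetric])
    moreover have "energy Y w f = (\<Sum>x\<in>Y. \<Sum>y\<in>Y. w x y * (f x * (f x - f y))) +
        (\<Sum>x\<in>Y. \<Sum>y\<in>Y. w x y * (f y * (f y - f x)))"
      unfolding energy_def sum.distrib[symmetric] distrib_left[symmetric]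
      by (intro sum.cong refl arg_cong2[of _ _ _ _ "(*)"]) (simp add: power2_eq_square algebra_simps)
    ultimately show ?thesis by simp
  qed
  have "(\<Sum>x\<in>Y. m x * (lazy_step Y w m N f x)\<^sup>2) =
      (\<Sum>x\<in>Y. m x * (f x)\<^sup>2 - f x * L x / N + (L x)\<^sup>2 / m x / (4 * N\<^sup>2))"
  proof (rule sum.cong[OF refl])
    fix x assume "x \<in> Y"
    then have "m x \<noteq> 0" using m by fastforce
    then show "m x * (lazy_step Y w m N f x)\<^sup>2 = m x * (f x)\<^sup>2 - f x * L x / N + (L x)\<^sup>2 / m x / (4 * N\<^sup>2)"
      using N unfolding lazy_step_def L_def[symmetric] by (simp add: power2_eq_square field_simps)
  qed
  also have "\<dots> = (\<Sum>x\<in>Y. m x * (f x)\<^sup>2) - energy Y w f / 2 / N + (\<Sum>x\<in>Y. (L x)\<^sup>2 / m x) / (4 * N\<^sup>2)"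
    by (simp only: sum.distrib sum_subtractf sum_divide_distrib[symmetric] fL)
  also have "(\<Sum>x\<in>Y. (L x)\<^sup>2 / m x) / (4 * N\<^sup>2) \<le> (N * energy Y w f) / (4 * N\<^sup>2)"
    unfolding energy_def by (subst sum_distrib_left) (intro divide_right_mono sum_mono cs, auto)
  also have "(N * energy Y w f) / (4 * N\<^sup>2) = energy Y w f / (4 * N)"
    using N by (simp add: power2_eq_square)
  finally show ?thesis by (simp add: field_simps)
qed

text \<open>Iterates keep mean zero, so by Cheeger's inequality each step loses at least the
  fraction \<open>c\<^sup>2 / (4 * N\<^sup>2)\<close> of the second moment. The bound
  \<open>c \<le> N\<close> keeps the remaining factor nonnegative, so the induction hypothesis can
  be multiplied by it.\<close>

lemma lazy_step_funpow_contraction: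
  fixes w :: "'x \<Rightarrow> 'x \<Rightarrow> real"
  assumes Y: "finite Y" and sym: "\<And>x y. w x y = w y x" and w: "\<And>x y. 0 \<le> w x y"
    and deg: "\<And>x. x \<in> Y \<Longrightarrow> (\<Sum>y\<in>Y. w x y) \<le> N * m x" and m: "\<And>x. x \<in> Y \<Longrightarrow> 0 < m x"
    and N: "0 < N"
    and iso: "\<And>A. A \<subseteq> Y \<Longrightarrow> 2 * sum m A \<le> sum m Y \<Longrightarrow> c * sum m A \<le> cut Y w A"
    and c: "0 \<le> c" "c \<le> N" and mean: "(\<Sum>x\<in>Y. m x * f x) = 0"
  shows "(\<Sum>x\<in>Y. m x * ((lazy_step Y w m N ^^ j) f x)\<^sup>2) \<le>
    (1 - c\<^sup>2 / (4 * N\<^sup>2)) ^ j * (\<Sum>x\<in>Y. m x * (f x)\<^sup>2)"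
proof (induction j)
  case (Suc j)
  let ?g = "(lazy_step Y w m N ^^ j) f" and ?q = "1 - c\<^sup>2 / (4 * N\<^sup>2)"
  have mean_g: "(\<Sum>x\<in>Y. m x * ?g x) = 0"
    by (induction j) (simp_all add: sum_lazy_step[of w Y m, OF sym m] mean)
  have "c\<^sup>2 \<le> N\<^sup>2" using c by (intro power_mono) auto
  then have "c\<^sup>2 \<le> 4 * N\<^sup>2" using zero_le_power2[of N] by linarith
  then have q: "0 \<le> ?q" using N by simp
  have "c\<^sup>2 * (\<Sum>x\<in>Y. m x * (?g x)\<^sup>2) \<le> N * energy Y w ?g"
    by (rule cheeger_inequality[OF Y sym w deg _ iso c(1) _ mean_g]) (use m N in \<open>auto simp: less_imp_le\<close>)
  then have "c\<^sup>2 / (4 * N\<^sup>2) * (\<Sum>x\<in>Y. m x * (?g x)\<^sup>2) \<le> energy Y w ?g / (4 * N)"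
    using N by (simp add: field_simps power2_eq_square)
  moreover have "(\<Sum>x\<in>Y. m x * ((lazy_step Y w m N ^^ Suc j) f x)\<^sup>2) \<le>
      (\<Sum>x\<in>Y. m x * (?g x)\<^sup>2) - energy Y w ?g / (4 * N)"
    using lazy_step_energy[OF Y sym w deg m N, of ?g] by simp
  ultimately have "(\<Sum>x\<in>Y. m x * ((lazy_step Y w m N ^^ Suc j) f x)\<^sup>2) \<le> ?q * (\<Sum>x\<in>Y. m x * (?g x)\<^sup>2)"
    by (simp add: left_diff_distrib)
  also have "\<dots> \<le> ?q * (?q ^ j * (\<Sum>x\<in>Y. m x * (f x)\<^sup>2))"
    using Suc.IH q by (intro mult_left_mono) auto
  finally show ?case by (simp add: mult.assoc)
qed simp

section \<open>Approximating the average by a kernel of finite range\<close>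

lemma square_add3_le: "(a + b + c)\<^sup>2 \<le> 3 * (a\<^sup>2 + b\<^sup>2 + c\<^sup>2)" for a b c :: real
  using sum_squares_bound[of a b] sum_squares_bound[of a c] sum_squares_bound[of b c]
  by (simp add: power2_eq_square algebra_simps)

text \<open>Averaging with respect to \<open>m\<close> has the constant kernel 1. The kernel
  \<open>k\<close> is that of \<open>j\<close> steps of the walk on an expanding subset
  \<open>Y\<close> of almost full mass, extended by zero. The walk contributes the power to the
  squared error, discarding the complement of \<open>Y\<close> contributes two terms \<alpha>, and
  the 3 comes from squaring a sum of three.\<close>

lemma exists_local_averaging_kernel:
  fixes w :: "'x::metric_space \<Rightarrow> 'x \<Rightarrow> real"
  assumes X: "finite X" and sym: "\<And>x y. w x y = w y x" and w: "\<And>x y. 0 \<le> w x y"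
    and deg: "\<And>x. x \<in> X \<Longrightarrow> (\<Sum>y\<in>X. w x y) \<le> N * m x" and m: "\<And>x. x \<in> X \<Longrightarrow> 0 < m x"
    and total: "sum m X = 1" and \<alpha>: "0 < \<alpha>" "\<alpha> \<le> 1/4" and c: "0 \<le> c" "c < \<kappa>" "c \<le> N" and N: "0 < N"
    and mid: "\<And>A. A \<subseteq> X \<Longrightarrow> \<alpha> \<le> sum m A \<Longrightarrow> sum m A \<le> 1 - \<alpha> \<Longrightarrow> \<kappa> \<le> cut X w A"
    and loc: "\<And>x y. w x y \<noteq> 0 \<Longrightarrow> dist x y \<le> R" "0 \<le> R"
  shows "\<exists>k. (\<forall>x y. k x y \<noteq> 0 \<longrightarrow> dist x y \<le> real j * R) \<and>
    (\<forall>f. (\<Sum>x\<in>X. m x * (\<Sum>y\<in>X. (1 - k x y) * (m y * f y))\<^sup>2) \<le>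
      3 * ((1 - c\<^sup>2 / (4 * N\<^sup>2)) ^ j + 2 * \<alpha>) * (\<Sum>x\<in>X. m x * (f x)\<^sup>2))"
proof -
  define q where "q = (1 - c\<^sup>2 / (4 * N\<^sup>2)) ^ j"
  have "c\<^sup>2 \<le> N\<^sup>2" using c by (intro power_mono) auto
  then have "c\<^sup>2 \<le> 4 * N\<^sup>2" using zero_le_power2[of N] by linarith
  then have q0: "0 \<le> q" unfolding q_def using N by (intro zero_le_power) simp
  have m0: "0 \<le> m x" if "x \<in> X" for x using m[OF that] by simp
  obtain F where F: "F \<subseteq> X" "sum m F < \<alpha>" and iso:
    "\<And>A. A \<subseteq> X - F \<Longrightarrow> 2 * sum m A \<le> sum m (X - F) \<Longrightarrow> c * sum m A \<le> cut (X - F) w A"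
    using exists_expanding_subset[OF X w m0 total \<alpha> c(1,2) mid] by metis
  define Y where "Y = X - F"
  have Y: "finite Y" "Y \<subseteq> X" "X = Y \<union> F" "Y \<inter> F = {}" "finite F"
    using X F by (auto simp: Y_def intro: finite_subset)
  have split: "sum g X = sum g Y + sum g F" for g :: "'x \<Rightarrow> real"
    using Y by (metis sum.union_disjoint)
  have mF: "sum m F = 1 - sum m Y" "0 \<le> sum m F"
    using split[of m] total F m0 by (auto intro: sum_nonneg)
  have mY: "0 < sum m Y" "sum m Y \<le> 1" using mF F(2) \<alpha> by auto
  have degY: "(\<Sum>y\<in>Y. w x y) \<le> N * m x" if "x \<in> Y" for x
  proof -
    have "(\<Sum>y\<in>Y. w x y) \<le> (\<Sum>y\<in>X. w x y)" using X Y(2) w by (intro sum_mono2) auto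
    then show ?thesis using deg[of x] that Y(2) by auto
  qed
  \<comment> \<open>Point masses are divided by \<open>m y\<close> because kernels are integrated
    against \<open>m\<close>: the sum of \<open>m y * f y * \<delta> y x\<close> over
    \<open>y\<close> in \<open>Y\<close> restores \<open>f x\<close> on \<open>Y\<close>.\<close>
  define \<delta> where "\<delta> y x = (if x = y then 1 / m y else 0)" for x y :: 'x
  define k where "k x y = (if x \<in> Y \<and> y \<in> Y then (lazy_step Y w m N ^^ j) (\<delta> y) x else 0)" for x y
  have "dist x y \<le> real j * R" if "k x y \<noteq> 0" for x y
    by (rule lazy_step_funpow_local[OF loc, where f = "\<delta> y" and Y = Y and m = m and N = N])
       (use that in \<open>auto simp: k_def \<delta>_def split: if_splits\<close>)
  moreover have "(\<Sum>x\<in>X. m x * (\<Sum>y\<in>X. (1 - k x y) * (m y * f y))\<^sup>2) \<le>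
      3 * (q + 2 * \<alpha>) * (\<Sum>x\<in>X. m x * (f x)\<^sup>2)" for f
  proof -
    define S where "S Z = (\<Sum>x\<in>Z. m x * (f x)\<^sup>2)" for Z
    have S0: "0 \<le> S Y" "0 \<le> S F"
      unfolding S_def using m0 F Y by (auto intro!: sum_nonneg mult_nonneg_nonneg)
    define s where "s = (\<Sum>x\<in>Y. m x * f x)"
    define a where "a = s / sum m Y"
    define b where "b = (\<Sum>x\<in>F. m x * f x)"
    \<comment> \<open>\<open>f\<close> is cut to \<open>Y\<close> before its mean over
      \<open>Y\<close> is removed, so that \<open>h + a\<close> equals the combination of the
      \<delta> functions at every point, off \<open>Y\<close> too; the linearity lemmas need an
      equality of functions.\<close>
    define h where "h x = (if x \<in> Y then f x else 0) - a" for x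
    define g where "g = (lazy_step Y w m N ^^ j) h"
    have s: "s = a * sum m Y" using mY by (simp add: a_def)
    have mean: "(\<Sum>x\<in>Y. m x * h x) = 0"
      using s by (simp add: h_def right_diff_distrib sum_subtractf s_def mult.commute flip: sum_distrib_left)
    have "(\<Sum>x\<in>Y. m x * (g x)\<^sup>2) \<le> q * (\<Sum>x\<in>Y. m x * (h x)\<^sup>2)"
      unfolding g_def q_def
      by (rule lazy_step_funpow_contraction[OF Y(1) sym w degY _ N _ c(1,3) mean])
         (use iso m in \<open>auto simp: Y_def\<close>)
    also have "(\<Sum>x\<in>Y. m x * (h x)\<^sup>2) = S Y - a\<^sup>2 * sum m Y"
    proof -
      have "(\<Sum>x\<in>Y. m x * (h x)\<^sup>2) = (\<Sum>x\<in>Y. m x * (f x - a)\<^sup>2)"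
        by (simp add: h_def)
      also have "\<dots> = S Y - 2 * a * s + a\<^sup>2 * sum m Y"
        by (simp only: sum_weighted_square_diff_const S_def s_def)
      finally show ?thesis by (simp add: s power2_eq_square)
    qed
    also have "q * (S Y - a\<^sup>2 * sum m Y) \<le> q * S Y"
      using q0 mY by (intro mult_left_mono) auto
    finally have g: "(\<Sum>x\<in>Y. m x * (g x)\<^sup>2) \<le> q * S Y" .
    have "s\<^sup>2 \<le> sum m Y * S Y"
      unfolding s_def S_def using m0 Y(2) by (intro weighted_Cauchy_Schwarz) auto
    then have a2: "a\<^sup>2 * sum m Y \<le> S Y"
      using mY by (simp add: s power2_eq_square mult_ac)
    have "b\<^sup>2 \<le> sum m F * S F"
      unfolding b_def S_def using m0 F by (intro weighted_Cauchy_Schwarz) auto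
    also have "\<dots> \<le> \<alpha> * S F" using F(2) S0 by (intro mult_right_mono) auto
    finally have b2: "b\<^sup>2 \<le> \<alpha> * S F" .
    have k: "(\<Sum>y\<in>X. k x y * (m y * f y)) = (if x \<in> Y then g x + a else 0)" for x
    proof (cases "x \<in> Y")
      case True
      have "(\<lambda>x. \<Sum>y\<in>Y. (m y * f y) * \<delta> y x) = (\<lambda>x. h x + a)"
      proof
        fix x
        have "(\<Sum>y\<in>Y. (m y * f y) * \<delta> y x) = (\<Sum>y\<in>Y. if y = x then f x else 0)"
        proof (rule sum.cong[OF refl])
          fix y assume "y \<in> Y"
          then have "m y \<noteq> 0" using m[of y] Y(2) by auto
          then show "(m y * f y) * \<delta> y x = (if y = x then f x else 0)" by (auto simp: \<delta>_def)
        qed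
        then show "(\<Sum>y\<in>Y. (m y * f y) * \<delta> y x) = h x + a" using Y(1) by (simp add: h_def)
      qed
      then have "(\<Sum>y\<in>Y. (m y * f y) * (lazy_step Y w m N ^^ j) (\<delta> y) x) = g x + a"
        using lazy_step_funpow_sum[of j Y w m N "\<lambda>y. m y * f y" \<delta> Y]
          lazy_step_funpow_add_const[of j Y w m N h a] by (metis g_def)
      moreover have "k x y = 0" if "y \<in> F" for y using that Y(4) by (auto simp: k_def)
      ultimately show ?thesis using True by (simp add: split k_def mult_ac)
    qed (simp add: k_def)
    define D where "D x = (\<Sum>y\<in>X. (1 - k x y) * (m y * f y))" for x
    \<comment> \<open>On \<open>Y\<close> this is \<open>b - a * sum m F - g x\<close>, and on
      \<open>F\<close> it is \<open>b + a * sum m Y\<close>. Apart from the walk remainder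
      \<open>g\<close>, each term is small in value or is integrated only over the light set
      \<open>F\<close>.\<close>
    have D: "D x = s + b - (if x \<in> Y then g x + a else 0)" for x
      using k[of x] split[of "\<lambda>x. m x * f x"]
      by (simp add: D_def left_diff_distrib sum_subtractf s_def b_def)
    have DY: "(D x)\<^sup>2 \<le> 3 * (b\<^sup>2 + (a * sum m F)\<^sup>2 + (g x)\<^sup>2)" if "x \<in> Y" for x
    proof -
      have "D x = b + (- (a * sum m F)) + (- g x)"
        using that by (simp add: D s mF(1) algebra_simps)
      then show ?thesis using square_add3_le[of b "- (a * sum m F)" "- g x"] by simp
    qed
    have DF: "(D x)\<^sup>2 \<le> 3 * (b\<^sup>2 + (a * sum m Y)\<^sup>2)" if "x \<in> F" for x
    proof -
      have "D x = b + a * sum m Y + 0" using that Y(4) by (auto simp: D s)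
      then show ?thesis using square_add3_le[of b "a * sum m Y" 0] by simp
    qed
    have "(\<Sum>x\<in>X. m x * (D x)\<^sup>2) \<le> (\<Sum>x\<in>Y. m x * (3 * (b\<^sup>2 + (a * sum m F)\<^sup>2 + (g x)\<^sup>2))) +
        (\<Sum>x\<in>F. m x * (3 * (b\<^sup>2 + (a * sum m Y)\<^sup>2)))"
      unfolding split by (intro add_mono sum_mono mult_left_mono DY DF m0) (use F Y in auto)
    also have "\<dots> = 3 * (b\<^sup>2 * (sum m Y + sum m F) + (a\<^sup>2 * sum m Y) * sum m F * (sum m Y + sum m F) +
        (\<Sum>x\<in>Y. m x * (g x)\<^sup>2))"
    proof -
      have e1: "(\<Sum>x\<in>Z. m x * (3 * (C + (g x)\<^sup>2))) = 3 * C * sum m Z + 3 * (\<Sum>x\<in>Z. m x * (g x)\<^sup>2)" for C Z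
        by (simp add: algebra_simps sum.distrib sum_distrib_left sum_distrib_right)
      have e2: "(\<Sum>x\<in>Z. m x * (3 * C)) = 3 * C * sum m Z" for C Z
        by (simp add: mult.commute flip: sum_distrib_right)
      show ?thesis
        by (simp only: e1 e2) (simp add: power2_eq_square algebra_simps)
    qed
    also have "\<dots> = 3 * (b\<^sup>2 + (a\<^sup>2 * sum m Y) * sum m F + (\<Sum>x\<in>Y. m x * (g x)\<^sup>2))"
      by (simp add: mF(1))
    also have "\<dots> \<le> 3 * (\<alpha> * (S Y + S F) + (S Y + S F) * \<alpha> + q * (S Y + S F))"
    proof -
      have "(a\<^sup>2 * sum m Y) * sum m F \<le> S Y * \<alpha>"
        using a2 F(2) mF(2) S0 by (intro mult_mono) auto
      moreover have "0 \<le> \<alpha> * S Y" "0 \<le> \<alpha> * S F" "0 \<le> q * S F" using S0 \<alpha> q0 by auto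
      ultimately show ?thesis using b2 g by (simp add: algebra_simps)
    qed
    also have "S Y + S F = (\<Sum>x\<in>X. m x * (f x)\<^sup>2)"
      by (simp add: S_def split)
    finally show ?thesis by (simp add: D_def algebra_simps)
  qed
  ultimately show ?thesis unfolding q_def by blast
qed


section \<open>From vertex boundaries to weighted cuts\<close>

text \<open>The minimum is symmetric and at most \<open>m x\<close>, so for nonnegative
  \<open>m\<close> the degree at \<open>x\<close> is at most the size of an \<open>R\<close>-ball
  times \<open>m x\<close>, however uneven \<open>m\<close> is.\<close>

definition min_weight :: "'x::metric_space set \<Rightarrow> real \<Rightarrow> ('x \<Rightarrow> real) \<Rightarrow> 'x \<Rightarrow> 'x \<Rightarrow> real" where
  "min_weight X R m x y = (if x \<in> X \<and> y \<in> X \<and> dist x y \<le> R then min (m x) (m y) else 0)"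

lemma min_weight_commute: "min_weight X R m x y = min_weight X R m y x"
  by (auto simp: min_weight_def dist_commute min.commute)

lemma boundary_inE:
  assumes "y \<in> boundary_in X R A" "finite A" "A \<noteq> {}"
  obtains x where "y \<in> X" "y \<notin> A" "x \<in> A" "dist x y \<le> R"
proof -
  have "infdist y A \<in> dist y ` A"
    unfolding infdist_notempty[OF assms(3)] using assms by (intro closed_contains_Inf finite_imp_closed) auto
  then obtain x where "x \<in> A" "infdist y A = dist y x" by blast
  then show ?thesis using assms(1) that by (auto simp: boundary_in_def dist_commute)
qed

text \<open>A small cut \<open>W\<close> forces the set of points of \<open>A\<close> with a heavier neighbour outside \<open>A\<close> to have
  measure at most \<open>W\<close>; what remains of \<open>A\<close> has vertex boundary at most \<open>2 W\<close>.\<close>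

lemma cut_lower_bound:
  fixes X :: "'x::metric_space set" and m :: "'x \<Rightarrow> real"
  assumes X: "finite X" and m: "\<And>x. x \<in> X \<Longrightarrow> 0 \<le> m x" and total: "sum m X = 1"
    and \<alpha>: "0 < \<alpha>" and c: "0 < c" "c < 1"
    and vertex: "\<And>A. A \<subseteq> X \<Longrightarrow> \<alpha> / 2 \<le> sum m A \<Longrightarrow> sum m A \<le> 1/2 \<Longrightarrow>
      c * sum m A < sum m (boundary_in X R A)"
    and A: "A \<subseteq> X" "\<alpha> \<le> sum m A" "sum m A \<le> 1 - \<alpha>"
  shows "c * \<alpha> / 4 \<le> cut X (min_weight X R m) A"
proof -
  have half: "c * \<alpha> / 4 \<le> cut X (min_weight X R m) A"
    if A: "A \<subseteq> X" "\<alpha> \<le> sum m A" "sum m A \<le> 1/2" for A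
  proof (rule ccontr)
    let ?w = "min_weight X R m" and ?W = "cut X (min_weight X R m) A"
    assume small: "\<not> c * \<alpha> / 4 \<le> ?W"
    have finA: "finite A" "finite (X - A)" using A(1) X by (auto intro: finite_subset)
    have w0: "0 \<le> ?w x y" for x y using m by (auto simp: min_weight_def)
    define D where "D = {x \<in> A. \<exists>y\<in>X - A. dist x y \<le> R \<and> m x \<le> m y}"
    define B where "B = A - D"
    have D: "D \<subseteq> A" "finite D" using finA by (auto simp: D_def)
    have "sum m D \<le> (\<Sum>x\<in>D. \<Sum>y\<in>X - A. ?w x y)"
    proof (rule sum_mono)
      fix x assume x: "x \<in> D"
      then obtain y where y: "y \<in> X - A" "dist x y \<le> R" "m x \<le> m y" by (auto simp: D_def)
      then have "m x = ?w x y" using x D(1) A(1) by (auto simp: min_weight_def)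
      also have "\<dots> \<le> (\<Sum>y\<in>X - A. ?w x y)"
        using y(1) finA w0 by (intro member_le_sum) auto
      finally show "m x \<le> (\<Sum>y\<in>X - A. ?w x y)" .
    qed
    also have "\<dots> \<le> ?W"
      unfolding cut_def using D finA w0 by (intro sum_mono2 sum_nonneg) auto
    finally have mD: "sum m D \<le> ?W" .
    have mB: "sum m B = sum m A - sum m D"
      unfolding B_def using finA D by (intro sum_diff) auto
    have "c * \<alpha> < 1 * \<alpha>" using c \<alpha> by (intro mult_strict_right_mono)
    \<comment> \<open>\<open>D\<close> weighs at most the cut, which is below \<alpha>/4, so
      \<open>B\<close> keeps at least half of \<alpha>; hence the threshold in
      \<open>vertex\<close>.\<close>
    then have B_ge: "\<alpha> / 2 \<le> sum m B" using mB mD A(2) small \<alpha> by linarith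
    then have "B \<noteq> {}" using \<alpha> by auto
    then have B: "B \<noteq> {}" "finite B" "B \<subseteq> X" using finA A(1) by (auto simp: B_def)
    have "0 \<le> sum m D" using D A(1) m by (intro sum_nonneg) auto
    then have "c * sum m B < sum m (boundary_in X R B)"
      using vertex[OF B(3) B_ge] mB A(3) by simp
    also have "\<dots> \<le> sum m (D \<union> (boundary_in X R B - D))"
      using X D A(1) m by (intro sum_mono2) (auto simp: boundary_in_def)
    also have "\<dots> = sum m D + sum m (boundary_in X R B - D)"
      using X D by (intro sum.union_disjoint) (auto simp: boundary_in_def)
    also have "sum m (boundary_in X R B - D) \<le> (\<Sum>y\<in>boundary_in X R B - D. \<Sum>x\<in>A. ?w x y)"
    proof (rule sum_mono)
      fix y assume y: "y \<in> boundary_in X R B - D"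
      then obtain x where x: "y \<in> X" "y \<notin> B" "x \<in> B" "dist x y \<le> R"
        using boundary_inE[OF _ B(2,1)] by blast
      then have "y \<notin> A" "x \<in> A" "x \<notin> D" using y by (auto simp: B_def)
      \<comment> \<open>\<open>x\<close> lies in \<open>A\<close> but not in \<open>D\<close>, so
        its neighbour \<open>y\<close> outside \<open>A\<close> is strictly lighter and the minimum
        is \<open>m y\<close>.\<close>
      then have "m y < m x" using x by (auto simp: D_def)
      then have "m y = ?w x y" using x B(3) by (auto simp: min_weight_def)
      also have "\<dots> \<le> (\<Sum>x\<in>A. ?w x y)"
        using \<open>x \<in> A\<close> finA w0 by (intro member_le_sum) auto
      finally show "m y \<le> (\<Sum>x\<in>A. ?w x y)" .
    qed
    also have "\<dots> \<le> (\<Sum>y\<in>X - A. \<Sum>x\<in>A. ?w x y)"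
      using finA w0 by (intro sum_mono2 sum_nonneg) (auto simp: boundary_in_def B_def)
    also have "\<dots> = ?W" unfolding cut_def by (rule sum.swap)
    finally have "c * sum m B < 2 * ?W" using mD by simp
    moreover have "c * (\<alpha> / 2) \<le> c * sum m B" using B_ge c by (intro mult_left_mono) auto
    ultimately show False using small by simp
  qed
  \<comment> \<open>A set of more than half the mass is replaced by its complement, which has the
    same cut by symmetry.\<close>
  show ?thesis
  proof (cases "sum m A \<le> 1/2")
    case False
    have mc: "sum m (X - A) = 1 - sum m A"
      using sum_diff[OF X A(1), of m] total by simp
    have "cut X (min_weight X R m) (X - A) = cut X (min_weight X R m) A"
      unfolding cut_def by (subst sum.swap) (simp add: double_diff[OF A(1) subset_refl] min_weight_commute)
    then show ?thesis using half[of "X - A"] mc A False by simp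
  qed (use half A in blast)
qed

section \<open>Finitely supported functions\<close>

lemma l2_eqI: "(\<And>x. l2_apply f x = l2_apply g x) \<Longrightarrow> f = g"
  by (simp add: l2_apply_inject[symmetric] fun_eq_iff)

lemma l2_apply_sum: "l2_apply (\<Sum>i\<in>I. g i) x = (\<Sum>i\<in>I. l2_apply (g i) x)"
  by (induction I rule: infinite_finite_induct) (simp_all add: zero_l2.rep_eq plus_l2.rep_eq)

lemma l2_apply_sum_single:
  assumes "finite G"
  shows "l2_apply (\<Sum>y\<in>G. l2_single y (g y)) x = (if x \<in> G then g x else 0)"
  using assms by (simp add: l2_apply_sum l2_single.rep_eq)

lemma cinner_zero_left [simp]: "cinner 0 x = 0"
  using cinner_add_left[of 0 0 x] by simp

lemma cinner_zero_right [simp]: "cinner x 0 = 0"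
  using cinner_commute[of x 0] by simp

lemma scaleC_zero_left [simp]: "0 *\<^sub>C x = 0"
  using scaleC_add_left[of 0 0 x] by simp

lemma scaleC_zero_right [simp]: "c *\<^sub>C (0::'a::complex_hilbert) = 0"
  using scaleC_add_right[of c 0 "0::'a"] by simp

lemma cinner_l2_finite:
  assumes "finite G" "\<And>x. x \<notin> G \<Longrightarrow> l2_apply f x = 0"
  shows "cinner f g = (\<Sum>x\<in>G. cinner (l2_apply f x) (l2_apply g x))"
proof -
  have "(\<Sum>\<^sub>\<infinity>x. cinner (l2_apply f x) (l2_apply g x)) = (\<Sum>\<^sub>\<infinity>x\<in>G. cinner (l2_apply f x) (l2_apply g x))"
    by (rule infsum_cong_neutral) (auto simp: assms(2))
  then show ?thesis using assms(1) by (simp add: cinner_l2_def)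
qed

lemma norm_l2_finite:
  assumes "finite G" "\<And>x. x \<notin> G \<Longrightarrow> l2_apply f x = 0"
  shows "(norm f)\<^sup>2 = (\<Sum>x\<in>G. (norm (l2_apply f x))\<^sup>2)"
proof -
  have "complex_of_real ((norm f)\<^sup>2) = complex_of_real (\<Sum>x\<in>G. (norm (l2_apply f x))\<^sup>2)"
    by (simp only: of_real_sum flip: cinner_self) (rule cinner_l2_finite[OF assms])
  then show ?thesis by (simp only: of_real_eq_iff)
qed

lemma norm_l2_leI:
  assumes "\<And>G. finite G \<Longrightarrow> (\<Sum>x\<in>G. (norm (l2_apply f x))\<^sup>2) \<le> C"
  shows "(norm f)\<^sup>2 \<le> C"
proof -
  have "(\<Sum>\<^sub>\<infinity>x. (norm (l2_apply f x))\<^sup>2) \<le> C"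
    by (intro infsum_le_finite_sums l2_summable assms)
  then show ?thesis by (simp add: norm_l2_def infsum_nonneg)
qed

lemma l2_finite_approx:
  assumes "0 < d"
  shows "\<exists>G. finite G \<and> norm (f - (\<Sum>y\<in>G. l2_single y (l2_apply f y))) < d"
proof -
  define S where "S = (\<Sum>\<^sub>\<infinity>x. (norm (l2_apply f x))\<^sup>2)"
  have "((\<lambda>x. (norm (l2_apply f x))\<^sup>2) has_sum S) UNIV"
    unfolding S_def using l2_summable[of f] by simp
  then have "\<forall>\<^sub>F G in finite_subsets_at_top UNIV. dist (\<Sum>x\<in>G. (norm (l2_apply f x))\<^sup>2) S < (d/2)\<^sup>2"
    unfolding has_sum_def using assms by (intro tendstoD) auto
  then obtain G where G: "finite G" "dist (\<Sum>x\<in>G. (norm (l2_apply f x))\<^sup>2) S < (d/2)\<^sup>2"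
    unfolding eventually_finite_subsets_at_top by auto
  let ?g = "\<Sum>y\<in>G. l2_single y (l2_apply f y)"
  have "(norm (f - ?g))\<^sup>2 \<le> (d/2)\<^sup>2"
  proof (rule norm_l2_leI)
    fix H :: "'a set" assume H: "finite H"
    have "(\<Sum>x\<in>H. (norm (l2_apply (f - ?g) x))\<^sup>2) = (\<Sum>x\<in>H - G. (norm (l2_apply f x))\<^sup>2)"
      by (rule sum.mono_neutral_cong_right)
         (use H G in \<open>auto simp: minus_l2.rep_eq l2_apply_sum_single\<close>)
    also have "\<dots> = (\<Sum>x\<in>H \<union> G. (norm (l2_apply f x))\<^sup>2) - (\<Sum>x\<in>G. (norm (l2_apply f x))\<^sup>2)"
      using sum_diff[of "H \<union> G" G "\<lambda>x. (norm (l2_apply f x))\<^sup>2"] H G(1) by (simp add: Un_Diff)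
    also have "(\<Sum>x\<in>H \<union> G. (norm (l2_apply f x))\<^sup>2) \<le> S"
      unfolding S_def using H G by (intro finite_sum_le_infsum l2_summable) auto
    finally show "(\<Sum>x\<in>H. (norm (l2_apply (f - ?g) x))\<^sup>2) \<le> (d/2)\<^sup>2"
      using G(2) by (simp add: dist_real_def)
  qed
  then have "norm (f - ?g) \<le> d/2" using assms by (auto intro: power2_le_imp_le)
  then show ?thesis using G(1) assms by (intro exI[of _ G]) auto
qed

lemma blinfun_eq_on_single:
  fixes T U :: "('x, 'h::complex_hilbert) l2 \<Rightarrow>\<^sub>L 'b::real_normed_vector"
  assumes eq: "\<And>y v. blinfun_apply T (l2_single y v) = blinfun_apply U (l2_single y v)"
  shows "T = U"
proof (rule blinfun_eqI)
  fix f
  let ?D = "T - U"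
  have "norm (blinfun_apply ?D f) \<le> 0 + d" if "0 < d" for d
  proof -
    define d' where "d' = d / (norm ?D + 1)"
    have d': "0 < d'" using that by (simp add: d'_def add_nonneg_pos)
    obtain G where G: "finite G" "norm (f - (\<Sum>y\<in>G. l2_single y (l2_apply f y))) < d'"
      using l2_finite_approx[OF d'] by blast
    have "blinfun_apply ?D f = blinfun_apply ?D (f - (\<Sum>y\<in>G. l2_single y (l2_apply f y)))"
      by (simp add: blinfun.bilinear_simps blinfun.sum_right eq)
    then have "norm (blinfun_apply ?D f) \<le> norm ?D * norm (f - (\<Sum>y\<in>G. l2_single y (l2_apply f y)))"
      by (simp only: norm_blinfun)
    also have "\<dots> \<le> norm ?D * d'" using G(2) by (intro mult_left_mono) auto
    also have "\<dots> \<le> (norm ?D + 1) * d'" using d' by (intro mult_right_mono) auto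
    also have "\<dots> = d" by (simp add: d'_def add_nonneg_eq_0_iff)
    finally show ?thesis by simp
  qed
  then have "norm (blinfun_apply ?D f) \<le> 0" by (rule field_le_epsilon)
  then show "blinfun_apply T f = blinfun_apply U f" by (simp add: blinfun.bilinear_simps)
qed

section \<open>From finite propagation to expansion\<close>

lemma finite_propagation_approx_imp_expanders:
  fixes X :: "nat \<Rightarrow> 'x::metric_space set"
    and P :: "('x, 'h::complex_hilbert) l2 \<Rightarrow>\<^sub>L ('x, 'h) l2"
  assumes fin: "\<And>n. finite (X n)" and P: "associated_measure X P m"
    and cl: "P \<in> closure {T. finite_propagation T}"
  shows "measured_asymptotic_expanders X m"
  unfolding measured_asymptotic_expanders_def
proof (intro allI impI)
  fix \<alpha> :: real assume \<alpha>: "0 < \<alpha> \<and> \<alpha> \<le> 1/2"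
  obtain \<xi> where supp: "\<And>n. \<xi> n \<in> l2_supported (X n)" and unit: "\<And>n. norm (\<xi> n) = 1"
    and P\<xi>: "\<And>n \<eta>. \<eta> \<in> l2_supported (X n) \<Longrightarrow> blinfun_apply P \<eta> = cinner \<eta> (\<xi> n) *\<^sub>C \<xi> n"
    and m: "\<And>n x. m n x = (norm (l2_apply (\<xi> n) x))\<^sup>2"
    using P unfolding associated_measure_def by blast
  \<comment> \<open>The square of this tolerance is \<alpha>/4, which below yields
    \<open>b \<le> 1/4\<close> for every \<open>A\<close> of mass at least \<alpha>.\<close>
  have "0 < sqrt \<alpha> / 2" using \<alpha> by simp
  then obtain T where T: "finite_propagation T" "dist T P < sqrt \<alpha> / 2"
    using cl unfolding closure_approachable by blast
  obtain K where K: "\<And>x y. matrix_entry T x y \<noteq> 0 \<Longrightarrow> dist x y \<le> K"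
    using T(1) unfolding finite_propagation_def bdd_above_def by blast
  define R where "R = \<bar>K\<bar> + 1"
  have "sum (m n) (boundary_in (X n) R A) > 1/4 * sum (m n) A"
    if A: "A \<subseteq> X n" "\<alpha> \<le> sum (m n) A" "sum (m n) A \<le> 1/2" for n A
  proof -
    \<comment> \<open>The part of the block farther than \<open>R\<close> from \<open>A\<close>. The
      test vector \<open>v\<close> is \<open>\<xi> n\<close> restricted to \<open>B\<close>:
      \<open>T\<close> cannot carry it into \<open>A\<close>, whereas \<open>P\<close> spreads it
      over the whole block with coefficient \<open>b\<close>.\<close>
    define B where "B = X n - A - boundary_in (X n) R A"
    have B: "finite B" "B \<subseteq> X n" "finite A" using fin A(1) by (auto simp: B_def intro: finite_subset)
    have bd: "boundary_in (X n) R A \<subseteq> X n - A" by (auto simp: boundary_in_def)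
    define b where "b = sum (m n) B"
    define v where "v = (\<Sum>y\<in>B. l2_single y (l2_apply (\<xi> n) y))"
    have v: "l2_apply v x = (if x \<in> B then l2_apply (\<xi> n) x else 0)" for x
      using B(1) by (simp add: v_def l2_apply_sum_single)
    have norm_v: "(norm v)\<^sup>2 = sum (m n) B"
      by (subst norm_l2_finite[OF B(1)]) (auto simp: v m)
    have "v \<in> l2_supported (X n)" using B by (auto simp: l2_supported_def v)
    moreover have "cinner v (\<xi> n) = complex_of_real (sum (m n) B)"
      by (subst cinner_l2_finite[OF B(1)]) (auto simp: v m cinner_self)
    ultimately have Pv: "blinfun_apply P v = complex_of_real b *\<^sub>C \<xi> n"
      using P\<xi> by (simp add: b_def)
    have Tv: "l2_apply (blinfun_apply T v) x = 0" if "x \<in> A" for x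
    proof -
      have "matrix_entry T x y = 0" if "y \<in> B" for y
      proof (rule ccontr)
        assume "matrix_entry T x y \<noteq> 0"
        then have "infdist y A \<le> R"
          using K[of x y] infdist_le[OF \<open>x \<in> A\<close>, of y] by (simp add: R_def dist_commute)
        then show False using \<open>y \<in> B\<close> by (auto simp: B_def boundary_in_def)
      qed
      then have "l2_apply (blinfun_apply T (l2_single y w)) x = 0" if "y \<in> B" for y w
        using that by (metis matrix_entry.rep_eq blinfun.zero_left)
      then show ?thesis by (simp add: v_def blinfun.sum_right l2_apply_sum)
    qed
    have mn: "0 \<le> m n x" for x by (simp add: m)
    have nonneg: "0 \<le> b" "0 \<le> sum (m n) A" by (auto simp: b_def mn intro: sum_nonneg)
    \<comment> \<open>On \<open>A\<close> only \<open>P v\<close>, that is \<open>b\<close> times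
      \<open>\<xi> n\<close>, survives. Comparison with the norm of \<open>v\<close>, whose square
      is \<open>b\<close>, bounds \<open>b\<close>.\<close>
    have "(b)\<^sup>2 * sum (m n) A = (\<Sum>x\<in>A. (norm (l2_apply (blinfun_apply (P - T) v) x))\<^sup>2)"
      by (simp add: blinfun.diff_left minus_l2.rep_eq Tv Pv scaleC_l2.rep_eq norm_scaleC m
          power_mult_distrib sum_distrib_left)
    also have "\<dots> \<le> (norm (blinfun_apply (P - T) v))\<^sup>2"
      by (rule norm_l2_apply_sum_le[OF B(3)])
    also have "\<dots> \<le> (norm (P - T) * norm v)\<^sup>2"
      by (intro power_mono norm_blinfun) auto
    also have "\<dots> \<le> (sqrt \<alpha> / 2 * norm v)\<^sup>2"
      using T(2) by (intro power_mono mult_right_mono) (auto simp: dist_norm norm_minus_commute)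
    also have "\<dots> = \<alpha> / 4 * b"
      using \<alpha> by (simp add: power_mult_distrib norm_v[folded b_def] power_divide)
    finally have *: "b * (b * sum (m n) A) \<le> b * (\<alpha> / 4)"
      by (simp add: power2_eq_square mult_ac)
    have "b \<le> 1/4"
    proof (cases "b = 0")
      case False
      then have "b * sum (m n) A \<le> \<alpha> / 4"
        using * nonneg by (metis mult_le_cancel_left_pos less_eq_real_def)
      moreover have "b * \<alpha> \<le> b * sum (m n) A"
        using A nonneg by (intro mult_left_mono)
      ultimately have "b * \<alpha> \<le> 1/4 * \<alpha>" by simp
      then show ?thesis using \<alpha> by (simp only: mult_le_cancel_right_pos)
    qed simp
    moreover have "sum (m n) (X n) = 1"
      using norm_l2_finite[OF fin[of n], of "\<xi> n"] supp[of n] unit by (simp add: l2_supported_def m)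
    moreover have "sum (m n) B = sum (m n) (X n) - sum (m n) A - sum (m n) (boundary_in (X n) R A)"
      unfolding B_def using fin[of n] A(1) bd by (simp add: sum_diff finite_subset)
    \<comment> \<open>With \<open>A\<close> of mass at most 1/2 and \<open>b\<close> at most 1/4,
      the boundary has mass at least 1/4. So the constant 1/4 serves for every \<alpha>, and only
      \<open>R\<close> varies.\<close>
    ultimately show ?thesis using A(3) by (simp add: b_def)
  qed
  moreover have "0 < R" by (simp add: R_def)
  ultimately show "\<exists>c R. 0 < c \<and> c < 1 \<and> 0 < R \<and>
      (\<forall>n A. A \<subseteq> X n \<and> \<alpha> \<le> sum (m n) A \<and> sum (m n) A \<le> 1 / 2 \<longrightarrow>
        c * sum (m n) A < sum (m n) (boundary_in (X n) R A))"
    by (intro exI[of _ "1/4"] exI[of _ R]) auto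
qed

section \<open>Block operators given by kernels\<close>

text \<open>\<open>e\<close> glues vectors chosen on the separate blocks into one field, so that an
  operator on the direct sum is described by a single scalar kernel.\<close>

locale block_partition =
  fixes X :: "nat \<Rightarrow> 'x::metric_space set" and e :: "'x \<Rightarrow> 'h::complex_hilbert"
  assumes fin: "finite (X n)" and disj: "disjoint_family X" and cover: "(\<Union>n. X n) = UNIV"
begin

definition index :: "'x \<Rightarrow> nat" where
  "index x = (THE n. x \<in> X n)"

lemma index_eq: "x \<in> X n \<Longrightarrow> index x = n"
  unfolding index_def using disj by (intro the_equality) (auto simp: disjoint_family_on_def)

lemma mem_index: "x \<in> X (index x)"
  using cover index_eq by blast

definition mass :: "'x \<Rightarrow> real" where
  "mass x = (norm (e x))\<^sup>2"

text \<open>\<open>C\<close> bounds, on every block at once, the squared norm of the integral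
  operator with kernel \<open>k\<close> on real square-integrable functions for the masses.\<close>

definition kernel_bound :: "('x \<Rightarrow> 'x \<Rightarrow> real) \<Rightarrow> real \<Rightarrow> bool" where
  "kernel_bound k C \<longleftrightarrow> 0 \<le> C \<and> (\<forall>n f. (\<Sum>x\<in>X n. mass x * (\<Sum>y\<in>X n. k x y * (mass y * f y))\<^sup>2) \<le>
     C * (\<Sum>x\<in>X n. mass x * (f x)\<^sup>2))"

text \<open>With \<open>V f x = f x *\<^sub>C e x\<close>, an isometry from \<open>L\<^sup>2\<close> of the masses into \<open>\<ell>\<^sup>2(X; H\<^sub>0)\<close>, this is
  \<open>V \<circ> K \<circ> V\<^sup>*\<close> for the integral operator \<open>K\<close> with kernel \<open>k\<close>.\<close>

definition kernel_fun :: "('x \<Rightarrow> 'x \<Rightarrow> real) \<Rightarrow> ('x \<Rightarrow> 'h) \<Rightarrow> 'x \<Rightarrow> 'h" where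
  "kernel_fun k g x = (\<Sum>y\<in>X (index x). complex_of_real (k x y) * cinner (g y) (e y)) *\<^sub>C e x"

lemma kernel_fun_add: "kernel_fun k (\<lambda>x. f x + g x) x = kernel_fun k f x + kernel_fun k g x"
  by (simp add: kernel_fun_def cinner_add_left distrib_left sum.distrib scaleC_add_left)

lemma kernel_fun_scaleC: "kernel_fun k (\<lambda>x. c *\<^sub>C f x) x = c *\<^sub>C kernel_fun k f x"
  by (simp add: kernel_fun_def cinner_scaleC_left sum_distrib_left mult.left_commute scaleC_scaleC)

text \<open>The kernel is real, so the real and imaginary parts of the coefficients can be bounded
  separately. Passing from \<open>g\<close> to its coefficients along \<open>e\<close> does not
  increase the norm, by Cauchy-Schwarz at each point.\<close>

lemma kernel_fun_block_le:
  assumes "kernel_bound k C"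
  shows "(\<Sum>x\<in>X n. (norm (kernel_fun k g x))\<^sup>2) \<le> C * (\<Sum>x\<in>X n. (norm (g x))\<^sup>2)"
proof -
  define z where "z y = cinner (g y) (e y)" for y
  \<comment> \<open>Where the mass vanishes so do \<open>e y\<close> and \<open>z y\<close>, so the
    value given to the quotient there does no harm.\<close>
  define f where "f y = z y / complex_of_real (mass y)" for y
  have zf: "z y = complex_of_real (mass y) * f y" for y
    by (auto simp: f_def z_def mass_def)
  have norm_fun: "(norm (kernel_fun k g x))\<^sup>2 =
      mass x * (\<Sum>y\<in>X n. k x y * (mass y * Re (f y)))\<^sup>2 +
      mass x * (\<Sum>y\<in>X n. k x y * (mass y * Im (f y)))\<^sup>2" if "x \<in> X n" for x
    using index_eq[OF that]
    by (simp add: kernel_fun_def norm_scaleC power_mult_distrib z_def[symmetric] zf mass_def[symmetric]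
        cmod_power2 algebra_simps)
  have "(\<Sum>x\<in>X n. (norm (kernel_fun k g x))\<^sup>2) =
      (\<Sum>x\<in>X n. mass x * (\<Sum>y\<in>X n. k x y * (mass y * Re (f y)))\<^sup>2) +
      (\<Sum>x\<in>X n. mass x * (\<Sum>y\<in>X n. k x y * (mass y * Im (f y)))\<^sup>2)"
    by (simp add: norm_fun sum.distrib)
  also have "\<dots> \<le> C * (\<Sum>x\<in>X n. mass x * (Re (f x))\<^sup>2) + C * (\<Sum>x\<in>X n. mass x * (Im (f x))\<^sup>2)"
    using assms unfolding kernel_bound_def by (intro add_mono) auto
  also have "\<dots> = C * (\<Sum>x\<in>X n. mass x * (cmod (f x))\<^sup>2)"
    by (simp add: cmod_power2 distrib_left sum.distrib)
  also have "\<dots> \<le> C * (\<Sum>x\<in>X n. (norm (g x))\<^sup>2)"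
  proof (intro mult_left_mono sum_mono)
    fix x
    show "mass x * (cmod (f x))\<^sup>2 \<le> (norm (g x))\<^sup>2"
    proof (cases "mass x = 0")
      case False
      then have "0 < mass x" by (simp add: mass_def)
      have "(cmod (z x))\<^sup>2 \<le> (norm (g x) * norm (e x))\<^sup>2"
        unfolding z_def by (intro power_mono norm_cinner_le) auto
      also have "\<dots> = (norm (g x))\<^sup>2 * mass x" by (simp add: power_mult_distrib mass_def)
      finally have "mass x * (mass x * (cmod (f x))\<^sup>2) \<le> mass x * (norm (g x))\<^sup>2"
        using \<open>0 < mass x\<close> by (simp add: zf norm_mult power_mult_distrib power2_eq_square mult_ac)
      then show ?thesis using \<open>0 < mass x\<close> by (simp only: mult_le_cancel_left_pos)
    qed simp
  qed (use assms in \<open>auto simp: kernel_bound_def\<close>)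
  finally show ?thesis .
qed

lemma kernel_fun_sum_le:
  assumes k: "kernel_bound k C" and G: "finite G"
  shows "(\<Sum>x\<in>G. (norm (kernel_fun k (l2_apply g) x))\<^sup>2) \<le> C * (norm g)\<^sup>2"
proof -
  define I where "I = index ` G"
  have I: "finite I" using G by (simp add: I_def)
  have GI: "G \<subseteq> (\<Union>n\<in>I. X n)" using mem_index by (auto simp: I_def)
  have disj': "\<forall>i\<in>I. \<forall>j\<in>I. i \<noteq> j \<longrightarrow> X i \<inter> X j = {}"
    using disj by (auto simp: disjoint_family_on_def)
  have "(\<Sum>x\<in>G. (norm (kernel_fun k (l2_apply g) x))\<^sup>2) \<le>
      (\<Sum>x\<in>(\<Union>n\<in>I. X n). (norm (kernel_fun k (l2_apply g) x))\<^sup>2)"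
    using GI I fin by (intro sum_mono2) auto
  also have "\<dots> = (\<Sum>n\<in>I. \<Sum>x\<in>X n. (norm (kernel_fun k (l2_apply g) x))\<^sup>2)"
    using I fin disj' by (intro sum.UNION_disjoint) auto
  also have "\<dots> \<le> (\<Sum>n\<in>I. C * (\<Sum>x\<in>X n. (norm (l2_apply g x))\<^sup>2))"
    by (intro sum_mono kernel_fun_block_le k)
  also have "\<dots> = C * (\<Sum>n\<in>I. \<Sum>x\<in>X n. (norm (l2_apply g x))\<^sup>2)"
    by (simp add: sum_distrib_left)
  also have "(\<Sum>n\<in>I. \<Sum>x\<in>X n. (norm (l2_apply g x))\<^sup>2) = (\<Sum>x\<in>(\<Union>n\<in>I. X n). (norm (l2_apply g x))\<^sup>2)"
    using I fin disj' by (intro sum.UNION_disjoint[symmetric]) auto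
  also have "C * \<dots> \<le> C * (norm g)\<^sup>2"
    using I fin k by (intro mult_left_mono norm_l2_apply_sum_le) (auto simp: kernel_bound_def)
  finally show ?thesis .
qed

text \<open>A \<open>kernel_bound\<close> guarantees square summable values and a bounded linear
  map, so that both abstraction functions act as intended.\<close>

definition kernel_op :: "('x \<Rightarrow> 'x \<Rightarrow> real) \<Rightarrow> ('x, 'h) l2 \<Rightarrow>\<^sub>L ('x, 'h) l2" where
  "kernel_op k = Blinfun (\<lambda>g. Abs_l2 (kernel_fun k (l2_apply g)))"

lemma kernel_fun_l2:
  assumes "kernel_bound k C"
  shows "l2_apply (Abs_l2 (kernel_fun k (l2_apply g))) = kernel_fun k (l2_apply g)"
proof -
  have "(\<lambda>x. (norm (kernel_fun k (l2_apply g) x))\<^sup>2) summable_on UNIV"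
    by (rule nonneg_bdd_above_summable_on)
       (auto intro!: bdd_aboveI2 kernel_fun_sum_le[OF assms])
  then show ?thesis by (simp add: Abs_l2_inverse)
qed

lemma norm_kernel_fun_le:
  assumes k: "kernel_bound k C"
  shows "norm (Abs_l2 (kernel_fun k (l2_apply g))) \<le> norm g * sqrt C"
proof -
  have C: "0 \<le> C" using k by (simp add: kernel_bound_def)
  have "(norm (Abs_l2 (kernel_fun k (l2_apply g))))\<^sup>2 \<le> C * (norm g)\<^sup>2"
    by (rule norm_l2_leI) (simp add: kernel_fun_l2[OF k] kernel_fun_sum_le[OF k])
  then have "(norm (Abs_l2 (kernel_fun k (l2_apply g))))\<^sup>2 \<le> (norm g * sqrt C)\<^sup>2"
    using C by (simp add: power_mult_distrib mult.commute)
  then show ?thesis by (rule power2_le_imp_le) (simp add: C)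
qed

lemma kernel_op_apply:
  assumes k: "kernel_bound k C"
  shows "blinfun_apply (kernel_op k) g = Abs_l2 (kernel_fun k (l2_apply g))"
proof -
  have "bounded_linear (\<lambda>g. Abs_l2 (kernel_fun k (l2_apply g)))"
  proof (rule bounded_linear_intro[where K = "sqrt C"])
    fix f g :: "('x, 'h) l2" and r :: real
    show "Abs_l2 (kernel_fun k (l2_apply (f + g))) =
        Abs_l2 (kernel_fun k (l2_apply f)) + Abs_l2 (kernel_fun k (l2_apply g))"
      by (rule l2_eqI) (simp only: plus_l2.rep_eq[of "Abs_l2 u" "Abs_l2 v" for u v] kernel_fun_l2[OF k],
          simp only: plus_l2.rep_eq kernel_fun_add)
    show "Abs_l2 (kernel_fun k (l2_apply (r *\<^sub>R f))) = r *\<^sub>R Abs_l2 (kernel_fun k (l2_apply f))"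
      by (rule l2_eqI) (simp only: scaleC_l2.rep_eq[of _ "Abs_l2 u" for u] kernel_fun_l2[OF k] flip: scaleC_of_real,
          simp only: scaleC_l2.rep_eq kernel_fun_scaleC)
  qed (rule norm_kernel_fun_le[OF k])
  then show ?thesis unfolding kernel_op_def by (simp add: bounded_linear_Blinfun_apply)
qed

lemma l2_apply_kernel_op:
  assumes "kernel_bound k C"
  shows "l2_apply (blinfun_apply (kernel_op k) g) x = kernel_fun k (l2_apply g) x"
  by (simp add: kernel_op_apply[OF assms] kernel_fun_l2[OF assms])

lemma norm_kernel_op_le:
  assumes k: "kernel_bound k C"
  shows "norm (kernel_op k) \<le> sqrt C"
  by (rule norm_blinfun_bound)
     (use k norm_kernel_fun_le[OF k] in \<open>auto simp: kernel_op_apply[OF k] kernel_bound_def mult.commute\<close>)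

lemma complex_linear_kernel_op:
  assumes k: "kernel_bound k C"
  shows "complex_linear (kernel_op k)"
  unfolding complex_linear_def
  by (intro allI l2_eqI) (simp only: l2_apply_kernel_op[OF k] scaleC_l2.rep_eq kernel_fun_scaleC)

lemma kernel_op_diff:
  assumes "kernel_bound k C" "kernel_bound k' C'" "kernel_bound (\<lambda>x y. k x y - k' x y) D"
  shows "kernel_op k - kernel_op k' = kernel_op (\<lambda>x y. k x y - k' x y)"
proof (intro blinfun_eqI l2_eqI)
  fix g x
  have *: "a *\<^sub>C v - b *\<^sub>C v = (a - b) *\<^sub>C v" for a b and v :: 'h
    using scaleC_add_left[of "a - b" b v] by simp
  show "l2_apply (blinfun_apply (kernel_op k - kernel_op k') g) x =
      l2_apply (blinfun_apply (kernel_op (\<lambda>x y. k x y - k' x y)) g) x"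
    by (simp add: blinfun.diff_left minus_l2.rep_eq assms[THEN l2_apply_kernel_op] kernel_fun_def *
        left_diff_distrib sum_subtractf)
qed

lemma matrix_entry_kernel_op:
  assumes "kernel_bound k C"
  shows "blinfun_apply (matrix_entry (kernel_op k) x y) v =
    (if y \<in> X (index x) then complex_of_real (k x y) * cinner v (e y) else 0) *\<^sub>C e x"
proof -
  have "(\<Sum>z\<in>X (index x). complex_of_real (k x z) * cinner (l2_apply (l2_single y v) z) (e z)) =
      (\<Sum>z\<in>X (index x). if z = y then complex_of_real (k x y) * cinner v (e y) else 0)"
    by (intro sum.cong) (auto simp: l2_single.rep_eq)
  then show ?thesis
    using fin by (simp add: matrix_entry.rep_eq l2_apply_kernel_op[OF assms] kernel_fun_def)
qed

lemma finite_propagation_kernel_op: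
  assumes "kernel_bound k C" and "\<And>x y. k x y \<noteq> 0 \<Longrightarrow> dist x y \<le> R"
  shows "finite_propagation (kernel_op k)"
  unfolding finite_propagation_def
proof (rule bdd_aboveI)
  fix d assume "d \<in> {dist x y |x y. matrix_entry (kernel_op k) x y \<noteq> 0}"
  then obtain x y where d: "d = dist x y" and "matrix_entry (kernel_op k) x y \<noteq> 0" by blast
  then obtain v where "blinfun_apply (matrix_entry (kernel_op k) x y) v \<noteq> 0"
    by (metis blinfun.zero_left blinfun_eqI)
  then have "k x y \<noteq> 0" by (auto simp: matrix_entry_kernel_op[OF assms(1)] split: if_splits)
  then show "d \<le> R" using d assms(2) by simp
qed

end

text \<open>The unit ball is mapped into the multiples of \<open>b\<close> with coefficients in a
  fixed disc, which form a compact set.\<close>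

lemma compact_operator_rank_one:
  fixes T :: "'a::complex_hilbert \<Rightarrow>\<^sub>L 'b::complex_hilbert"
  assumes T: "\<And>v. blinfun_apply T v = (c * cinner v a) *\<^sub>C b"
  shows "compact_operator T"
proof -
  have "bounded_linear (\<lambda>z. z *\<^sub>C b)"
    by (rule bounded_linear_intro[where K = "norm b"])
       (auto simp: scaleC_add_left norm_scaleC scaleR_conv_of_real scaleC_scaleC[symmetric] scaleC_of_real)
  then have K: "compact ((\<lambda>z. z *\<^sub>C b) ` cball 0 (cmod c * norm a))"
    by (intro compact_continuous_image linear_continuous_on) auto
  have "blinfun_apply T ` cball 0 1 \<subseteq> (\<lambda>z. z *\<^sub>C b) ` cball 0 (cmod c * norm a)"
  proof
    fix u assume "u \<in> blinfun_apply T ` cball 0 1"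
    then obtain v where v: "norm v \<le> 1" "u = (c * cinner v a) *\<^sub>C b" by (auto simp: T)
    have "cmod (cinner v a) \<le> 1 * norm a"
      by (rule order_trans[OF norm_cinner_le]) (use v in \<open>intro mult_right_mono, auto\<close>)
    then have "cmod (c * cinner v a) \<le> cmod c * norm a"
      by (simp add: norm_mult mult_left_mono)
    then show "u \<in> (\<lambda>z. z *\<^sub>C b) ` cball 0 (cmod c * norm a)" using v(2) by auto
  qed
  then have "closure (blinfun_apply T ` cball 0 1) \<subseteq> (\<lambda>z. z *\<^sub>C b) ` cball 0 (cmod c * norm a)"
    using K by (intro closure_minimal compact_imp_closed)
  then have "closure (blinfun_apply T ` cball 0 1) =
      (\<lambda>z. z *\<^sub>C b) ` cball 0 (cmod c * norm a) \<inter> closure (blinfun_apply T ` cball 0 1)"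
    by blast
  also have "compact \<dots>" using K by (intro compact_Int_closed) auto
  finally show ?thesis unfolding compact_operator_def .
qed

context block_partition
begin

lemma locally_compact_kernel_op:
  assumes "kernel_bound k C"
  shows "locally_compact_operator (kernel_op k)"
  unfolding locally_compact_operator_def
proof (intro allI)
  fix x y
  show "compact_operator (matrix_entry (kernel_op k) x y)"
    by (rule compact_operator_rank_one[where
          c = "if y \<in> X (index x) then complex_of_real (k x y) else 0" and a = "e y" and b = "e x"])
       (simp add: matrix_entry_kernel_op[OF assms])
qed

text \<open>Averaging against a probability measure is a contraction by Cauchy-Schwarz; this kernel
  will represent \<open>P\<close>.\<close>

lemma kernel_bound_one:
  assumes "\<And>n. sum mass (X n) = 1"
  shows "kernel_bound (\<lambda>x y. 1) 1"
  unfolding kernel_bound_def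
proof (intro conjI allI)
  fix n and f :: "'x \<Rightarrow> real"
  have "(\<Sum>x\<in>X n. mass x * (\<Sum>y\<in>X n. 1 * (mass y * f y))\<^sup>2) = (\<Sum>y\<in>X n. mass y * f y)\<^sup>2"
    by (simp add: assms flip: sum_distrib_right)
  also have "\<dots> \<le> sum mass (X n) * (\<Sum>x\<in>X n. mass x * (f x)\<^sup>2)"
    by (rule weighted_Cauchy_Schwarz) (simp add: mass_def)
  finally show "(\<Sum>x\<in>X n. mass x * (\<Sum>y\<in>X n. 1 * (mass y * f y))\<^sup>2) \<le> 1 * (\<Sum>x\<in>X n. mass x * (f x)\<^sup>2)"
    by (simp add: assms)
qed simp

lemma kernel_bound_diff:
  assumes "kernel_bound k C" "kernel_bound k' C'"
  shows "kernel_bound (\<lambda>x y. k x y - k' x y) (2 * C + 2 * C')"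
  unfolding kernel_bound_def
proof (intro conjI allI)
  fix n and f :: "'x \<Rightarrow> real"
  let ?g = "\<lambda>k x. \<Sum>y\<in>X n. k x y * (mass y * f y)" and ?S = "\<Sum>x\<in>X n. mass x * (f x)\<^sup>2"
  have sq: "(a - b)\<^sup>2 \<le> 2 * a\<^sup>2 + 2 * b\<^sup>2" for a b :: real
    using zero_le_power2[of "a + b"] by (simp add: power2_eq_square algebra_simps)
  have "(\<Sum>x\<in>X n. mass x * (?g (\<lambda>x y. k x y - k' x y) x)\<^sup>2) = (\<Sum>x\<in>X n. mass x * (?g k x - ?g k' x)\<^sup>2)"
    by (simp add: left_diff_distrib sum_subtractf)
  also have "\<dots> \<le> (\<Sum>x\<in>X n. mass x * (2 * (?g k x)\<^sup>2 + 2 * (?g k' x)\<^sup>2))"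
    by (intro sum_mono mult_left_mono sq) (simp add: mass_def)
  also have "\<dots> = 2 * (\<Sum>x\<in>X n. mass x * (?g k x)\<^sup>2) + 2 * (\<Sum>x\<in>X n. mass x * (?g k' x)\<^sup>2)"
    by (simp only: distrib_left sum.distrib sum_distrib_left mult.left_commute[of "mass _"])
  also have "\<dots> \<le> 2 * (C * ?S) + 2 * (C' * ?S)"
    using assms unfolding kernel_bound_def by (intro add_mono mult_left_mono) auto
  finally show "(\<Sum>x\<in>X n. mass x * (?g (\<lambda>x y. k x y - k' x y) x)\<^sup>2) \<le> (2 * C + 2 * C') * ?S"
    by (simp add: algebra_simps)
qed (use assms in \<open>auto simp: kernel_bound_def\<close>)

end

section \<open>From expansion to finite propagation\<close>

lemma min_weight_degree_le:
  assumes "finite Z" "\<And>x. x \<in> Z \<Longrightarrow> 0 \<le> m x" "finite (cball x R)" "real (card (cball x R)) \<le> N" "x \<in> Z"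
  shows "(\<Sum>y\<in>Z. min_weight Z R m x y) \<le> N * m x"
proof -
  have "(\<Sum>y\<in>Z. min_weight Z R m x y) = (\<Sum>y\<in>Z \<inter> cball x R. min_weight Z R m x y)"
    using assms(1) by (intro sum.mono_neutral_right) (auto simp: min_weight_def)
  also have "\<dots> \<le> (\<Sum>y\<in>Z \<inter> cball x R. m x)"
    using assms(2,5) by (intro sum_mono) (auto simp: min_weight_def)
  also have "\<dots> = real (card (Z \<inter> cball x R)) * m x" by simp
  also have "\<dots> \<le> N * m x"
    using assms card_mono[of "cball x R" "Z \<inter> cball x R"] by (intro mult_right_mono) auto
  finally show ?thesis .
qed

text \<open>All constants, and hence the number \<open>j\<close> of steps, are chosen before a block
  is fixed. The kernels found block by block therefore have a common range \<open>j * R\<close> and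
  a common error, and glue to one operator close to \<open>P\<close>.\<close>

lemma expanders_imp_approximable:
  fixes X :: "nat \<Rightarrow> 'x::metric_space set"
    and P :: "('x, 'h::complex_hilbert) l2 \<Rightarrow>\<^sub>L ('x, 'h) l2"
  assumes bg: "bounded_geometry TYPE('x)" and sparse: "sparse_space X"
    and P: "associated_measure X P m" and mae: "measured_asymptotic_expanders X m"
  shows "P \<in> closure {T. complex_linear T \<and> finite_propagation T \<and> locally_compact_operator T}"
proof -
  obtain \<xi> where supp: "\<And>n. \<xi> n \<in> l2_supported (X n)" and unit: "\<And>n. norm (\<xi> n) = 1"
    and P\<xi>: "\<And>n \<eta>. \<eta> \<in> l2_supported (X n) \<Longrightarrow> blinfun_apply P \<eta> = cinner \<eta> (\<xi> n) *\<^sub>C \<xi> n"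
    and m: "\<And>n x. m n x = (norm (l2_apply (\<xi> n) x))\<^sup>2"
    using P unfolding associated_measure_def by blast
  define e where "e x = l2_apply (\<xi> (THE n. x \<in> X n)) x" for x
  interpret block_partition X e
    using sparse by unfold_locales (auto simp: sparse_space_def)
  have e: "e x = l2_apply (\<xi> n) x" if "x \<in> X n" for x n
    using index_eq[OF that] by (simp add: e_def index_def)
  have mass: "mass x = m n x" if "x \<in> X n" for x n
    using e[OF that] by (simp add: mass_def m)
  have mass0: "0 \<le> mass x" for x by (simp add: mass_def)
  have \<xi>0: "l2_apply (\<xi> n) x = 0" if "x \<notin> X n" for n x
    using supp[of n] that by (simp add: l2_supported_def)
  have total: "sum mass (X n) = 1" for n
    using norm_l2_finite[OF fin[of n], of "\<xi> n"] \<xi>0 unit by (simp add: m mass)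
  note one = kernel_bound_one[OF total]
  \<comment> \<open>\<open>kernel_fun\<close> already pairs with \<open>e\<close> and multiplies by
    \<open>e\<close>, so the rank-one formula on each block leaves the constant kernel 1.\<close>
  have P_eq: "P = kernel_op (\<lambda>_ _. 1)"
  proof (intro blinfun_eq_on_single l2_eqI)
    fix x y :: 'x and v :: 'h
    have y: "l2_single y v \<in> l2_supported (X (index y))"
      using mem_index[of y] by (auto simp: l2_supported_def l2_single.rep_eq)
    have "cinner (l2_single y v) (\<xi> (index y)) = cinner v (e y)"
      using e[OF mem_index] by (subst cinner_l2_finite[of "{y}"]) (auto simp: l2_single.rep_eq)
    then have "l2_apply (blinfun_apply P (l2_single y v)) x =
        cinner v (e y) *\<^sub>C l2_apply (\<xi> (index y)) x"
      by (simp add: P\<xi>[OF y] scaleC_l2.rep_eq)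
    also have "\<dots> = (if y \<in> X (index x) then cinner v (e y) else 0) *\<^sub>C e x"
    proof (cases "index x = index y")
      case True
      then have "y \<in> X (index x)" "e x = l2_apply (\<xi> (index y)) x"
        using mem_index[of y] e[OF mem_index[of x]] by metis+
      then show ?thesis by simp
    next
      case False
      then have "y \<notin> X (index x)" "x \<notin> X (index y)" using index_eq by fastforce+
      then show ?thesis using \<xi>0 by simp
    qed
    also have "\<dots> = l2_apply (blinfun_apply (kernel_op (\<lambda>_ _. 1)) (l2_single y v)) x"
      using matrix_entry_kernel_op[OF one, of x y v] by (simp add: matrix_entry.rep_eq)
    finally show "l2_apply (blinfun_apply P (l2_single y v)) x =
        l2_apply (blinfun_apply (kernel_op (\<lambda>_ _. 1)) (l2_single y v)) x" .
  qed
  show ?thesis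
    unfolding closure_approachable
  proof (intro allI impI)
    fix d :: real assume d: "0 < d"
    \<comment> \<open>The bound 1/4 is for the expanding subset. The bound
      \<open>d\<^sup>2 / 48\<close>, together with \<open>q ^ j\<close> below
      \<open>d\<^sup>2 / 6\<close>, keeps \<open>C\<close> under 5/8 of
      \<open>d\<^sup>2\<close>.\<close>
    define \<alpha> where "\<alpha> = min (1/4) (d\<^sup>2 / 48)"
    have \<alpha>: "0 < \<alpha>" "\<alpha> \<le> 1/4" "\<alpha> \<le> d\<^sup>2 / 48" using d by (auto simp: \<alpha>_def)
    then have "0 < \<alpha> / 2 \<and> \<alpha> / 2 \<le> 1/2" by simp
    then obtain c\<^sub>0 R where c0: "0 < c\<^sub>0" "c\<^sub>0 < 1" and R: "0 < R" and vertex: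
      "\<And>n A. A \<subseteq> X n \<Longrightarrow> \<alpha> / 2 \<le> sum (m n) A \<Longrightarrow> sum (m n) A \<le> 1/2 \<Longrightarrow>
        c\<^sub>0 * sum (m n) A < sum (m n) (boundary_in (X n) R A)"
      using mae unfolding measured_asymptotic_expanders_def by metis
    obtain N\<^sub>0 where N0: "\<And>x::'x. finite (cball x R) \<and> card (cball x R) \<le> N\<^sub>0"
      using bg R unfolding bounded_geometry_def by metis
    \<comment> \<open>The maximum with 1 makes \<open>N\<close> positive and gives
      \<open>c \<le> N\<close>, as \<open>c\<close> will be below 1.\<close>
    define N where "N = real (max 1 N\<^sub>0)"
    have N: "1 \<le> N" "\<And>x::'x. real (card (cball x R)) \<le> N"
      using N0 by (auto simp: N_def intro: le_max_iff_disj[THEN iffD2])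
    define \<kappa> where "\<kappa> = c\<^sub>0 * \<alpha> / 4"
    define c where "c = \<kappa> / 2"
    have "c\<^sub>0 * \<alpha> \<le> 1 * (1/4)" using c0 \<alpha> by (intro mult_mono) auto
    then have c: "0 < c" "c < \<kappa>" "c \<le> N" using c0 \<alpha> N(1) by (auto simp: c_def \<kappa>_def)
    define q where "q = 1 - c\<^sup>2 / (4 * N\<^sup>2)"
    have "c\<^sup>2 \<le> N\<^sup>2" using c by (intro power_mono) auto
    then have "c\<^sup>2 \<le> 4 * N\<^sup>2" using zero_le_power2[of N] by linarith
    then have q: "0 \<le> q" "q < 1" using N(1) c(1) by (auto simp: q_def)
    have "0 < d\<^sup>2 / 6" using d by simp
    then obtain j where j: "q ^ j < d\<^sup>2 / 6"
      using q(2) real_arch_pow_inv by blast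
    define C where "C = 3 * (q ^ j + 2 * \<alpha>)"
    have C: "0 \<le> C" "C < d\<^sup>2"
      using j \<alpha> q d by (auto simp: C_def)
    have "\<exists>k. (\<forall>x y. k x y \<noteq> 0 \<longrightarrow> dist x y \<le> real j * R) \<and>
        (\<forall>f. (\<Sum>x\<in>X n. mass x * (\<Sum>y\<in>X n. (1 - k x y) * (mass y * f y))\<^sup>2) \<le>
          C * (\<Sum>x\<in>X n. mass x * (f x)\<^sup>2))" for n
    proof -
      \<comment> \<open>The walk divides by point masses, so null points are dropped; neither the
        sums nor the measures of boundaries notice them.\<close>
      define Z where "Z = {x \<in> X n. 0 < mass x}"
      have Z: "finite Z" "Z \<subseteq> X n" using fin by (auto simp: Z_def)
      have massZ: "mass x = 0" if "x \<in> X n - Z" for x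
        using that mass0[of x] by (auto simp: Z_def)
      have sumZ: "(\<Sum>x\<in>X n. mass x * g x) = (\<Sum>x\<in>Z. mass x * g x)" for g
        using fin Z massZ by (intro sum.mono_neutral_right) auto
      have totalZ: "sum mass Z = 1"
        using sumZ[of "\<lambda>_. 1"] total by simp
      have vertexZ: "c\<^sub>0 * sum mass A < sum mass (boundary_in Z R A)"
        if A: "A \<subseteq> Z" "\<alpha> / 2 \<le> sum mass A" "sum mass A \<le> 1/2" for A
      proof -
        have "sum (m n) B = sum mass B" if "B \<subseteq> X n" for B
          using that mass by (intro sum.cong) auto
        moreover have "boundary_in (X n) R A \<subseteq> X n" "A \<subseteq> X n" using A Z by (auto simp: boundary_in_def)
        ultimately have "c\<^sub>0 * sum mass A < sum mass (boundary_in (X n) R A)"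
          using vertex[of A n] A by simp
        also have "\<dots> = sum mass (boundary_in Z R A)"
        proof (rule sum.mono_neutral_right)
          show "finite (boundary_in (X n) R A)" using fin by (simp add: boundary_in_def)
          show "boundary_in Z R A \<subseteq> boundary_in (X n) R A" using Z by (auto simp: boundary_in_def)
          show "\<forall>x\<in>boundary_in (X n) R A - boundary_in Z R A. mass x = 0"
            by (intro ballI massZ) (auto simp: boundary_in_def)
        qed
        finally show ?thesis .
      qed
      have "\<exists>k. (\<forall>x y. k x y \<noteq> 0 \<longrightarrow> dist x y \<le> real j * R) \<and>
          (\<forall>f. (\<Sum>x\<in>Z. mass x * (\<Sum>y\<in>Z. (1 - k x y) * (mass y * f y))\<^sup>2) \<le>
          3 * ((1 - c\<^sup>2 / (4 * N\<^sup>2)) ^ j + 2 * \<alpha>) * (\<Sum>x\<in>Z. mass x * (f x)\<^sup>2))"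
      proof (rule exists_local_averaging_kernel[where w = "min_weight Z R mass" and \<kappa> = \<kappa>])
        show "min_weight Z R mass x y = min_weight Z R mass y x" for x y
          by (rule min_weight_commute)
        show "0 \<le> min_weight Z R mass x y" for x y using mass0 by (simp add: min_weight_def)
        show "(\<Sum>y\<in>Z. min_weight Z R mass x y) \<le> N * mass x" if "x \<in> Z" for x
          using Z N N0 mass0 that by (intro min_weight_degree_le) auto
        show "\<kappa> \<le> cut Z (min_weight Z R mass) A"
          if "A \<subseteq> Z" "\<alpha> \<le> sum mass A" "sum mass A \<le> 1 - \<alpha>" for A
          unfolding \<kappa>_def
          by (rule cut_lower_bound[OF Z(1) mass0 totalZ \<alpha>(1) c0 vertexZ that])
        show "dist x y \<le> R" if "min_weight Z R mass x y \<noteq> 0" for x y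
          using that by (auto simp: min_weight_def split: if_splits)
        show "0 < mass x" if "x \<in> Z" for x using that by (simp add: Z_def)
      qed (use Z \<alpha> c N R totalZ in auto)
      moreover have "(\<Sum>y\<in>X n. (1 - k x y) * (mass y * f y)) = (\<Sum>y\<in>Z. (1 - k x y) * (mass y * f y))"
        for k :: "'x \<Rightarrow> 'x \<Rightarrow> real" and x f
        using sumZ[of "\<lambda>y. (1 - k x y) * f y"] by (simp only: mult.left_commute)
      ultimately show ?thesis
        by (simp only: sumZ C_def q_def)
    qed
    from choice[OF allI[OF this]] obtain kk where kk_all:
      "\<forall>n. (\<forall>x y. kk n x y \<noteq> 0 \<longrightarrow> dist x y \<le> real j * R) \<and>
        (\<forall>f. (\<Sum>x\<in>X n. mass x * (\<Sum>y\<in>X n. (1 - kk n x y) * (mass y * f y))\<^sup>2) \<le>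
          C * (\<Sum>x\<in>X n. mass x * (f x)\<^sup>2))" ..
    have kk: "dist x y \<le> real j * R" if "kk n x y \<noteq> 0" for n x y
      using kk_all that by blast
    have kk_bound: "(\<Sum>x\<in>X n. mass x * (\<Sum>y\<in>X n. (1 - kk n x y) * (mass y * f y))\<^sup>2) \<le>
        C * (\<Sum>x\<in>X n. mass x * (f x)\<^sup>2)" for n f
      using kk_all by blast
    \<comment> \<open>The block of \<open>x\<close> selects the kernel. Values with \<open>y\<close>
      in another block never enter, because \<open>kernel_fun\<close> sums over the block of
      \<open>x\<close> only.\<close>
    define k where "k x y = kk (index x) x y" for x y
    have diff: "kernel_bound (\<lambda>x y. 1 - k x y) C"
      unfolding kernel_bound_def
    proof (intro conjI allI C)
      fix n and f :: "'x \<Rightarrow> real"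
      have "(\<Sum>x\<in>X n. mass x * (\<Sum>y\<in>X n. (1 - k x y) * (mass y * f y))\<^sup>2) =
          (\<Sum>x\<in>X n. mass x * (\<Sum>y\<in>X n. (1 - kk n x y) * (mass y * f y))\<^sup>2)"
        by (intro sum.cong refl) (simp add: k_def index_eq)
      then show "(\<Sum>x\<in>X n. mass x * (\<Sum>y\<in>X n. (1 - k x y) * (mass y * f y))\<^sup>2) \<le>
          C * (\<Sum>x\<in>X n. mass x * (f x)\<^sup>2)"
        using kk_bound by simp
    qed
    \<comment> \<open>\<open>k\<close> is the difference of the bounded kernels 1 and
      \<open>1 - k\<close>.\<close>
    have k: "kernel_bound k (2 * 1 + 2 * C)"
      using kernel_bound_diff[OF one diff] by simp
    have "dist P (kernel_op k) = norm (kernel_op (\<lambda>x y. 1 - k x y))"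
      using kernel_op_diff[OF one k diff] by (simp add: P_eq dist_norm)
    also have "\<dots> \<le> sqrt C" by (rule norm_kernel_op_le[OF diff])
    also have "\<dots> < d" using C d by (intro real_less_lsqrt) auto
    finally have "dist (kernel_op k) P < d" by (simp add: dist_commute)
    moreover have "finite_propagation (kernel_op k)"
      by (rule finite_propagation_kernel_op[OF k]) (auto simp: k_def intro: kk)
    ultimately show "\<exists>T\<in>{T. complex_linear T \<and> finite_propagation T \<and> locally_compact_operator T}. dist T P < d"
      using complex_linear_kernel_op[OF k] locally_compact_kernel_op[OF k] by blast
  qed
qed

theorem theorem2:
  fixes X :: "nat \<Rightarrow> 'x::metric_space set"
  assumes "bounded_geometry TYPE('x)" and "sparse_space X"
  shows
    "(\<forall>(P :: ('x, (nat, complex) l2) l2 \<Rightarrow>\<^sub>L ('x, (nat, complex) l2) l2) m.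
        block_rank_one_projection X P \<and> associated_measure X P m \<longrightarrow>
        (P \<in> roe_algebra \<longleftrightarrow> measured_asymptotic_expanders X m)) \<and>
     (\<forall>(P :: ('x, complex) l2 \<Rightarrow>\<^sub>L ('x, complex) l2) m.
        block_rank_one_projection X P \<and> associated_measure X P m \<longrightarrow>
        (P \<in> uniform_roe_algebra \<longleftrightarrow> measured_asymptotic_expanders X m))"
proof -
  have fin: "finite (X n)" for n using assms(2) by (simp add: sparse_space_def)
  \<comment> \<open>Each algebra lies between the closure of the complex linear, finite propagation,
    locally compact operators and the closure of all finite propagation operators. The two
    implications are proved for these extremes and so cover both cases.\<close>
  note to_mae = finite_propagation_approx_imp_expanders[OF fin _ subsetD[OF closure_mono]]
  note from_mae = subsetD[OF closure_mono expanders_imp_approximable[OF assms]]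
  show ?thesis
    unfolding roe_algebra_def uniform_roe_algebra_def
  proof (intro conjI allI impI iffI; elim conjE)
    fix P :: "('x, (nat, complex) l2) l2 \<Rightarrow>\<^sub>L ('x, (nat, complex) l2) l2" and m
    assume P: "associated_measure X P m"
    show "measured_asymptotic_expanders X m"
      if "P \<in> closure {T. complex_linear T \<and> finite_propagation T \<and> locally_compact_operator T}"
      by (rule to_mae[OF P _ that]) auto
    show "P \<in> closure {T. complex_linear T \<and> finite_propagation T \<and> locally_compact_operator T}"
      if "measured_asymptotic_expanders X m"
      by (rule expanders_imp_approximable[OF assms P that])
  next
    fix P :: "('x, complex) l2 \<Rightarrow>\<^sub>L ('x, complex) l2" and m
    assume P: "associated_measure X P m"
    show "measured_asymptotic_expanders X m"
      if "P \<in> closure {T. complex_linear T \<and> finite_propagation T}"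
      by (rule to_mae[OF P _ that]) auto
    show "P \<in> closure {T. complex_linear T \<and> finite_propagation T}"
      if "measured_asymptotic_expanders X m"
      by (rule from_mae[OF _ P that]) auto
  qed
qed

end
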